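(* The class $\operatorname{Kor}(\mathrm{LCG})$ contains the following: (1) the class $\operatorname{Kor}(\mathrm{SepLie})\cup\operatorname{Kor}(\mathrm{ConnLCG})$, and thus all compactly generated abelian Lie groups and all compact monothetic groups; (2) all groups of the form $C^D$ (with the product topology) where $C$ is a compact simple non-abelian group and $D$ is infinite; (3) all simple non-discrete totally disconnected locally compact groups; (4) all simple discrete groups of cardinality larger than $2^{\aleph_0}$; (5) all discrete simple groups that have infinite elementary abelian subgroups. Moreover, $\operatorname{Kor}(\mathrm{LCG})$ is closed under finite cartesian products but not under arbitrary cartesian products (with the product topology).
   Context: All topological groups are Hausdorff; classes of topological groups are closed under isomorphism of topological groups. For a topological group $G$, an ordinary representation of $G$ is a continuous homomorphism $\rho\colon G\to \mathrm{GL}_n(\mathbb{C})$ for some positive integer $n$, and $\operatorname{Kor}(G)$ denotes the intersection of the kernels of all ordinary representations of $G$ (over all $n$), with the subspace topology. For a class $\mathcal{G}$ of topological groups, $\operatorname{Kor}(\mathcal{G})$ is the class of all topological groups isomorphic to $\operatorname{Kor}(G)$ for some $G\in\mathcal{G}$. $\mathrm{LCG}$ is the class of locally compact groups, $\mathrm{ConnLCG}$ that of connected locally compact groups, and $\mathrm{SepLie}$ the class of separable, i.e. $\sigma$-compact, (real finite-dimensional) Lie groups, which includes all countable discrete groups. A compactly generated group is one generated as a group by a compact subset. A topological group is monothetic if it has a dense cyclic subgroup. An elementary abelian group is an abelian group of exponent $p$ for some prime $p$. *)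

theory Defs
  imports "HOL-Analysis.Analysis" "HOL-Algebra.Product_Groups" "HOL-Algebra.Generated_Groups"
    "HOL-Algebra.SimpleGroups" "Jordan_Normal_Form.Matrix"
begin

section \<open>Topological groups\<close>

record 'a topgroup = "'a monoid" +
  topol :: "'a topology"

locale topological_group = group G for G :: "'a topgroup" (structure) +
  assumes topspace_topol: "topspace (topol G) = carrier G"
    and Hausdorff_topol: "Hausdorff_space (topol G)"
    and continuous_mult:
      "continuous_map (prod_topology (topol G) (topol G)) (topol G) (\<lambda>(x, y). x \<otimes> y)"
    and continuous_inv: "continuous_map (topol G) (topol G) (\<lambda>x. inv x)"

definition topgroup_iso :: "'a topgroup \<Rightarrow> 'b topgroup \<Rightarrow> bool"  (infix \<open>\<cong>\<^sub>t\<close> 50)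
  where "G \<cong>\<^sub>t H \<longleftrightarrow> (\<exists>f \<in> iso G H. homeomorphic_map (topol G) (topol H) f)"

definition restrict_topgroup :: "'a topgroup \<Rightarrow> 'a set \<Rightarrow> 'a topgroup"
  where "restrict_topgroup G K =
    \<lparr>carrier = K, mult = mult G, one = one G, topol = subtopology (topol G) K\<rparr>"

definition product_topgroup :: "'i set \<Rightarrow> ('i \<Rightarrow> 'a topgroup) \<Rightarrow> ('i \<Rightarrow> 'a) topgroup"
  where "product_topgroup I G =
    \<lparr>carrier = carrier (product_group I G),
     mult = mult (product_group I G),
     one = one (product_group I G),
     topol = product_topology (\<lambda>i. topol (G i)) I\<rparr>"


section \<open>Ordinary representations and the operator Kor\<close>

definition mat_entries :: "nat \<Rightarrow> complex mat \<Rightarrow> nat \<times> nat \<Rightarrow> complex"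
  where "mat_entries n A = (\<lambda>ij \<in> {..<n} \<times> {..<n}. A $$ ij)"

text \<open>The topology of the general linear group is inherited from the space of all complex
  \<open>n \<times> n\<close> matrices, that is, from the \<open>n\<^sup>2\<close>-fold power of the complex numbers.\<close>

definition GL :: "nat \<Rightarrow> complex mat topgroup"
  where "GL n = (let U = units_of (ring_mat TYPE(complex) n ()) in
    \<lparr>carrier = carrier U, mult = mult U, one = one U,
     topol = pullback_topology (carrier U) (mat_entries n)
       (product_topology (\<lambda>_. euclidean) ({..<n} \<times> {..<n}))\<rparr>)"

definition ordinary_rep :: "'a topgroup \<Rightarrow> nat \<Rightarrow> ('a \<Rightarrow> complex mat) \<Rightarrow> bool"
  where "ordinary_rep G n \<rho> \<longleftrightarrow>
    n > 0 \<and> \<rho> \<in> hom G (GL n) \<and> continuous_map (topol G) (topol (GL n)) \<rho>"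

definition Kor :: "'a topgroup \<Rightarrow> 'a topgroup"
  where "Kor G = restrict_topgroup G (\<Inter>{kernel G (GL n) \<rho> | n \<rho>. ordinary_rep G n \<rho>})"

text \<open>A class of topological groups is represented by the set of its members with elements in a
  given type \<open>'u\<close>, which plays the role of a universe. The type of the members of the resulting
  class is not tied to \<open>'u\<close>: only the witness \<open>G\<close> has to live in the universe. Hence a group of
  a fixed type can be shown to lie outside the class for every choice of \<open>'u\<close>.\<close>

definition Kor_class :: "'u topgroup set \<Rightarrow> 'k topgroup set"
  where "Kor_class \<G> = {K. topological_group K \<and> (\<exists>G \<in> \<G>. K \<cong>\<^sub>t Kor G)}"


section \<open>Lie groups\<close>

text \<open>The space \<open>\<real>\<^sup>n\<close> is \<^const>\<open>Euclidean_space\<close>, the set of all sequences of real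
  numbers that vanish from index \<open>n\<close> on. Iterated partial derivatives define \<open>C\<^sup>k\<close>-functions
  on an open subset \<open>U\<close>.\<close>

definition partial_deriv :: "nat \<Rightarrow> ((nat \<Rightarrow> real) \<Rightarrow> real) \<Rightarrow> (nat \<Rightarrow> real) \<Rightarrow> real"
  where "partial_deriv i f x = deriv (\<lambda>t. f (x(i := t))) (x i)"

primrec Ck_on :: "nat \<Rightarrow> nat \<Rightarrow> (nat \<Rightarrow> real) set \<Rightarrow> ((nat \<Rightarrow> real) \<Rightarrow> real) \<Rightarrow> bool"
  where
    "Ck_on n 0 U f \<longleftrightarrow>
      continuous_map (subtopology (Euclidean_space n) U) euclideanreal f"
  | "Ck_on n (Suc k) U f \<longleftrightarrow>
      continuous_map (subtopology (Euclidean_space n) U) euclideanreal f \<and>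
      (\<forall>i<n. (\<forall>x\<in>U. (\<lambda>t. f (x(i := t))) differentiable (at (x i))) \<and>
             Ck_on n k U (partial_deriv i f))"

definition smooth_map_on ::
    "nat \<Rightarrow> nat \<Rightarrow> (nat \<Rightarrow> real) set \<Rightarrow> ((nat \<Rightarrow> real) \<Rightarrow> (nat \<Rightarrow> real)) \<Rightarrow> bool"
  where "smooth_map_on m n U F \<longleftrightarrow>
    openin (Euclidean_space m) U \<and> F ` U \<subseteq> topspace (Euclidean_space n) \<and>
    (\<forall>j<n. \<forall>k. Ck_on m k U (\<lambda>x. F x j))"

type_synonym 'a chart = "'a set \<times> ('a \<Rightarrow> nat \<Rightarrow> real)"

definition is_chart :: "nat \<Rightarrow> 'a topology \<Rightarrow> 'a chart \<Rightarrow> bool"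
  where "is_chart n X = (\<lambda>(U, \<xi>).
    openin X U \<and> openin (Euclidean_space n) (\<xi> ` U) \<and>
    homeomorphic_map (subtopology X U) (subtopology (Euclidean_space n) (\<xi> ` U)) \<xi>)"

definition smooth_atlas :: "nat \<Rightarrow> 'a topology \<Rightarrow> 'a chart set \<Rightarrow> bool"
  where "smooth_atlas n X \<A> \<longleftrightarrow>
    (\<forall>c\<in>\<A>. is_chart n X c) \<and> \<Union>(fst ` \<A>) = topspace X \<and>
    (\<forall>(U, \<xi>)\<in>\<A>. \<forall>(V, \<eta>)\<in>\<A>.
       smooth_map_on n n (\<xi> ` (U \<inter> V)) (\<lambda>x. \<eta> (inv_into U \<xi> x)))"

text \<open>The two projections of \<open>\<real>\<^sup>2\<^sup>n = \<real>\<^sup>n \<times> \<real>\<^sup>n\<close>.\<close>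

definition left_half :: "nat \<Rightarrow> (nat \<Rightarrow> real) \<Rightarrow> (nat \<Rightarrow> real)"
  where "left_half n z = (\<lambda>i. if i < n then z i else 0)"

definition right_half :: "nat \<Rightarrow> (nat \<Rightarrow> real) \<Rightarrow> (nat \<Rightarrow> real)"
  where "right_half n z = (\<lambda>i. if i < n then z (n + i) else 0)"

definition smooth_mult :: "nat \<Rightarrow> 'a topgroup \<Rightarrow> 'a chart set \<Rightarrow> bool"
  where "smooth_mult n G \<A> \<longleftrightarrow>
    (\<forall>(U, \<xi>)\<in>\<A>. \<forall>(V, \<eta>)\<in>\<A>. \<forall>(W, \<zeta>)\<in>\<A>.
      let p = (\<lambda>z. inv_into U \<xi> (left_half n z) \<otimes>\<^bsub>G\<^esub> inv_into V \<eta> (right_half n z)) in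
      smooth_map_on (2 * n) n
        {z \<in> topspace (Euclidean_space (2 * n)).
           left_half n z \<in> \<xi> ` U \<and> right_half n z \<in> \<eta> ` V \<and> p z \<in> W}
        (\<lambda>z. \<zeta> (p z)))"

definition smooth_inverse :: "nat \<Rightarrow> 'a topgroup \<Rightarrow> 'a chart set \<Rightarrow> bool"
  where "smooth_inverse n G \<A> \<longleftrightarrow>
    (\<forall>(U, \<xi>)\<in>\<A>. \<forall>(V, \<eta>)\<in>\<A>.
      let p = (\<lambda>x. inv\<^bsub>G\<^esub> (inv_into U \<xi> x)) in
      smooth_map_on n n {x \<in> \<xi> ` U. p x \<in> V} (\<lambda>x. \<eta> (p x)))"

definition lie_group :: "'a topgroup \<Rightarrow> bool"
  where "lie_group G \<longleftrightarrow> topological_group G \<and>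
    (\<exists>n \<A>. smooth_atlas n (topol G) \<A> \<and> smooth_mult n G \<A> \<and> smooth_inverse n G \<A>)"


section \<open>Classes and properties of topological groups\<close>

definition sigma_compact_space :: "'a topology \<Rightarrow> bool"
  where "sigma_compact_space X \<longleftrightarrow>
    (\<exists>K :: nat \<Rightarrow> 'a set. (\<forall>i. compactin X (K i)) \<and> (\<Union>i. K i) = topspace X)"

definition LCG :: "'a topgroup set"
  where "LCG = {G. topological_group G \<and> locally_compact_space (topol G)}"

definition ConnLCG :: "'a topgroup set"
  where "ConnLCG = {G \<in> LCG. connected_space (topol G)}"

definition SepLie :: "'a topgroup set"
  where "SepLie = {G. lie_group G \<and> sigma_compact_space (topol G)}"

definition compactly_generated :: "'a topgroup \<Rightarrow> bool"
  where "compactly_generated G \<longleftrightarrow>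
    (\<exists>K. compactin (topol G) K \<and> generate G K = carrier G)"

definition monothetic :: "'a topgroup \<Rightarrow> bool"
  where "monothetic G \<longleftrightarrow>
    (\<exists>g \<in> carrier G. (topol G) closure_of (generate G {g}) = carrier G)"

definition totally_disconnected_space :: "'a topology \<Rightarrow> bool"
  where "totally_disconnected_space X \<longleftrightarrow>
    (\<forall>x \<in> topspace X. connected_component_of_set X x = {x})"

definition discrete_topgroup :: "'a topgroup \<Rightarrow> bool"
  where "discrete_topgroup G \<longleftrightarrow> topol G = discrete_topology (carrier G)"

text \<open>The library locale \<^locale>\<open>simple_group\<close> requires \<open>order G > 1\<close>; since the order of an
  infinite group is \<open>0\<close> by convention, it excludes all infinite groups.\<close>

definition is_simple :: "'a topgroup \<Rightarrow> bool"
  where "is_simple G \<longleftrightarrow> group G \<and> carrier G \<noteq> {\<one>\<^bsub>G\<^esub>} \<and>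
    (\<forall>N. N \<lhd> G \<longrightarrow> N = {\<one>\<^bsub>G\<^esub>} \<or> N = carrier G)"

definition has_exponent :: "('a, 'b) monoid_scheme \<Rightarrow> nat \<Rightarrow> bool"
  where "has_exponent G m \<longleftrightarrow>
    m > 0 \<and> (\<forall>x \<in> carrier G. x [^]\<^bsub>G\<^esub> m = \<one>\<^bsub>G\<^esub>) \<and>
    (\<forall>k. 0 < k \<and> k < m \<longrightarrow> (\<exists>x \<in> carrier G. x [^]\<^bsub>G\<^esub> k \<noteq> \<one>\<^bsub>G\<^esub>))"

definition elementary_abelian :: "('a, 'b) monoid_scheme \<Rightarrow> bool"
  where "elementary_abelian G \<longleftrightarrow> comm_group G \<and> (\<exists>p. prime p \<and> has_exponent G p)"

end

theory Submission
  imports Defs "HOL-Algebra.Free_Abelian_Groups"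
begin

text \<open>Three mechanisms put elements into the common kernel of all ordinary representations.

  Central commutators: if \<open>X\<^sub>i\<close> commutes with \<open>Y\<^sub>j\<close> for all \<open>i \<noteq> j\<close>, then, \<open>n \<times> n\<close> matrices being
  vectors in a space of dimension \<open>n\<^sup>2\<close>, some \<open>X\<^sub>k\<close> commutes with \<open>Y\<^sub>k\<close>. Hence in a Heisenberg group over
  an abelian group \<open>A\<close> in which every \<open>s \<in> A\<close> is the commutator of infinitely many such pairs,
  representations are trivial on \<open>A\<close>; as the quotient by \<open>A\<close> is free abelian, \<open>A\<close> is exactly the
  Kor of this group. So every locally compact abelian group lies in the class.

  No small subgroups: the kernel of a representation contains every sufficiently small subgroup. By
  van Dantzig's theorem such subgroups exist in totally disconnected locally compact groups, and in
  \<open>C\<^sup>D\<close> they are the subpowers over cofinite subsets of \<open>D\<close>; adjoining a displacing action of the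
  integers on \<open>D\<close> leaves only \<open>C\<^sup>D\<close> as Kor.

  Size: the general linear group has the cardinality of the continuum, and its commuting elements of a
  given finite exponent are simultaneously diagonalizable, hence finite in number.

  Finally, Kor commutes with finite products and is always closed, hence locally compact in a locally
  compact group; an infinite power of the discrete integers is not locally compact.\<close>

section \<open>The general linear group\<close>

text \<open>Membership in a class is tied to a type: a witness must live on \<open>'u\<close>,
  whereas the natural witnesses live on product types. Those witnesses are therefore bounded in
  cardinality by the infinite type \<open>'u\<close> and copied along an injection, which is why
  cardinal arithmetic accompanies the constructions.

  The Heisenberg and shift groups need two bounds on Kor. From above, representations of degree one
  suffice: powers of 2 detect every integer coordinate of the quotient. From below, all degrees must
  be covered at once, and since the number of commuting pairs needed grows with the degree, each
  element of \<open>A\<close> is given infinitely many pairs.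

  For a power of \<open>C\<close> an enlargement is in general unavoidable: a compact Lie group
  \<open>C\<close> has a faithful representation, and composing it with the coordinate projections
  separates the points of the power. A simple group, in contrast, is its own Kor as soon as no
  representation is injective, so the three statements about simple groups reduce to finding one
  nontrivial element in each kernel.\<close>

lemma GL_simps:
  "carrier (GL n) = Units (ring_mat TYPE(complex) n ())"
  "mult (GL n) = (*)"
  "one (GL n) = 1\<^sub>m n"
  by (simp_all add: GL_def Let_def units_of_def ring_mat_simps)

lemma group_GL: "group (GL n)"
proof -
  interpret R: ring "ring_mat TYPE(complex) n ()" by (rule ring_mat)
  interpret U: group "units_of (ring_mat TYPE(complex) n ())" by (rule R.units_group)
  show ?thesis
    by (rule groupI)
      (use U.m_assoc U.l_one U.l_inv_ex U.m_closed U.one_closed in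
        \<open>auto simp: GL_def Let_def\<close>)
qed

lemma carrier_GL_carrier_mat: "A \<in> carrier (GL n) \<Longrightarrow> A \<in> carrier_mat n n"
  by (simp add: GL_simps Units_def ring_mat_simps)

lemma carrier_GL_I:
  "A \<in> carrier_mat n n \<Longrightarrow> B \<in> carrier_mat n n \<Longrightarrow> A * B = 1\<^sub>m n \<Longrightarrow> B * A = 1\<^sub>m n
    \<Longrightarrow> A \<in> carrier (GL n)"
  by (auto simp: GL_simps Units_def ring_mat_simps)

lemma topspace_GL: "topspace (topol (GL n)) = carrier (GL n)"
  by (auto simp: GL_def Let_def topspace_pullback_topology mat_entries_def)

text \<open>The topology of \<open>GL n\<close> is the initial one for \<open>mat_entries\<close>,
  so continuity can be tested entry by entry; that the values are invertible remains a separate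
  condition.\<close>

lemma continuous_map_GL_iff:
  "continuous_map X (topol (GL n)) \<rho> \<longleftrightarrow>
    \<rho> \<in> topspace X \<rightarrow> carrier (GL n) \<and>
    (\<forall>i<n. \<forall>j<n. continuous_map X euclidean (\<lambda>x. \<rho> x $$ (i, j)))" (is "?L \<longleftrightarrow> ?R")
proof -
  let ?P = "product_topology (\<lambda>_. euclidean :: complex topology) ({..<n} \<times> {..<n})"
  have top: "topol (GL n) = pullback_topology (carrier (GL n)) (mat_entries n) ?P"
    by (simp add: GL_def Let_def)
  have P: "continuous_map X ?P (mat_entries n \<circ> \<rho>) \<longleftrightarrow>
      (\<forall>i<n. \<forall>j<n. continuous_map X euclidean (\<lambda>x. \<rho> x $$ (i, j)))"
    by (auto simp: continuous_map_componentwise mat_entries_def o_def)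
  show ?thesis
  proof
    assume L: ?L
    have "continuous_map (topol (GL n)) ?P (mat_entries n)"
      using continuous_map_pullback[OF continuous_map_id[of ?P], of "carrier (GL n)" "mat_entries n"]
      by (simp add: top)
    then have "continuous_map X ?P (mat_entries n \<circ> \<rho>)"
      using L continuous_map_compose by blast
    moreover have "\<rho> \<in> topspace X \<rightarrow> carrier (GL n)"
      using L by (auto simp: continuous_map_def topspace_GL)
    ultimately show ?R using P by blast
  next
    assume ?R
    then show ?L
      unfolding top using P by (intro continuous_map_pullback') auto
  qed
qed

section \<open>Ordinary representations and Kor\<close>

context
  fixes G :: "'a topgroup" and n \<rho>
  assumes rep: "ordinary_rep G n \<rho>"
begin

lemma ordinary_rep_closed: "x \<in> carrier G \<Longrightarrow> \<rho> x \<in> carrier (GL n)"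
  using rep by (auto simp: ordinary_rep_def hom_def)

lemma ordinary_rep_carrier_mat: "x \<in> carrier G \<Longrightarrow> \<rho> x \<in> carrier_mat n n"
  by (rule carrier_GL_carrier_mat) (rule ordinary_rep_closed)

lemma ordinary_rep_mult:
  "x \<in> carrier G \<Longrightarrow> y \<in> carrier G \<Longrightarrow> \<rho> (x \<otimes>\<^bsub>G\<^esub> y) = \<rho> x * \<rho> y"
  using rep by (auto simp: ordinary_rep_def hom_def GL_simps)

lemma ordinary_rep_one: "group G \<Longrightarrow> \<rho> \<one>\<^bsub>G\<^esub> = 1\<^sub>m n"
  using rep hom_one[of \<rho> G "GL n"] group_GL by (auto simp: ordinary_rep_def GL_simps)

lemma ordinary_rep_entry_continuous:
  "i < n \<Longrightarrow> j < n \<Longrightarrow> continuous_map (topol G) euclidean (\<lambda>x. \<rho> x $$ (i, j))"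
  using rep by (auto simp: ordinary_rep_def continuous_map_GL_iff)

lemma group_hom_ordinary_rep: "group G \<Longrightarrow> group_hom G (GL n) \<rho>"
  using rep group_GL by (auto simp: ordinary_rep_def group_hom_def group_hom_axioms_def)

end

lemma ordinary_rep_comp:
  assumes "ordinary_rep H n \<rho>" "\<phi> \<in> hom G H" "continuous_map (topol G) (topol H) \<phi>"
  shows "ordinary_rep G n (\<rho> \<circ> \<phi>)"
  using assms hom_compose[of \<phi> G H \<rho> "GL n"] continuous_map_compose[of _ _ \<phi> _ \<rho>]
  by (auto simp: ordinary_rep_def)

text \<open>Guarantees that the family of ordinary representations is nonempty: an empty
  intersection of kernels would be the whole type rather than a subset of the carrier.\<close>

lemma ordinary_rep_trivial:
  "topspace (topol G) = carrier G \<Longrightarrow> ordinary_rep G 1 (\<lambda>_. 1\<^sub>m 1)"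
  using carrier_GL_I[of "1\<^sub>m 1" 1 "1\<^sub>m 1"]
  by (simp add: ordinary_rep_def hom_def GL_simps(2) topspace_GL)

lemma ordinary_rep_character:
  fixes ch :: "'a \<Rightarrow> complex"
  assumes "topspace (topol G) = carrier G"
    and mult: "\<And>x y. x \<in> carrier G \<Longrightarrow> y \<in> carrier G \<Longrightarrow> ch (x \<otimes>\<^bsub>G\<^esub> y) = ch x * ch y"
    and nz: "\<And>x. x \<in> carrier G \<Longrightarrow> ch x \<noteq> 0"
    and cont: "continuous_map (topol G) euclidean ch"
  shows "ordinary_rep G 1 (\<lambda>x. mat 1 1 (\<lambda>_. ch x))"
proof -
  have "mat 1 1 (\<lambda>_. ch x) \<in> carrier (GL 1)" if "x \<in> carrier G" for x
    by (rule carrier_GL_I[of _ _ "mat 1 1 (\<lambda>_. 1 / ch x)"])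
      (use nz[OF that] in \<open>auto intro!: eq_matI simp: scalar_prod_def\<close>)
  moreover have "mat 1 1 (\<lambda>_. ch (x \<otimes>\<^bsub>G\<^esub> y)) = mat 1 1 (\<lambda>_. ch x) * mat 1 1 (\<lambda>_. ch y)"
    if "x \<in> carrier G" "y \<in> carrier G" for x y
    by (rule eq_matI) (use mult[OF that] in \<open>auto simp: scalar_prod_def\<close>)
  ultimately show ?thesis
    using assms(1) cont by (auto simp: ordinary_rep_def hom_def GL_simps(2) continuous_map_GL_iff)
qed

lemma carrier_Kor:
  assumes "topspace (topol G) = carrier G"
  shows "carrier (Kor G) =
    {x \<in> carrier G. \<forall>n \<rho>. ordinary_rep G n \<rho> \<longrightarrow> \<rho> x = 1\<^sub>m n}"
proof -
  have "carrier (Kor G) = \<Inter>{kernel G (GL n) \<rho> | n \<rho>. ordinary_rep G n \<rho>}"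
    by (simp add: Kor_def restrict_topgroup_def)
  also have "\<dots> = {x. \<forall>n \<rho>. ordinary_rep G n \<rho> \<longrightarrow> x \<in> carrier G \<and> \<rho> x = 1\<^sub>m n}"
    unfolding kernel_def GL_simps by blast
  finally show ?thesis
    using ordinary_rep_trivial[OF assms] by blast
qed

lemma Kor_simps [simp]:
  "mult (Kor G) = mult G" "one (Kor G) = one G"
  "topol (Kor G) = subtopology (topol G) (carrier (Kor G))"
  by (simp_all add: Kor_def restrict_topgroup_def)

text \<open>Continuous multiplicative functions into the nonzero complex numbers are representations
  of degree one, so each of them bounds Kor from above.\<close>

lemma Kor_character:
  fixes ch :: "'a \<Rightarrow> complex"
  assumes ts: "topspace (topol G) = carrier G"
    and "\<And>x y. x \<in> carrier G \<Longrightarrow> y \<in> carrier G \<Longrightarrow> ch (x \<otimes>\<^bsub>G\<^esub> y) = ch x * ch y"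
    and "\<And>x. x \<in> carrier G \<Longrightarrow> ch x \<noteq> 0"
    and "continuous_map (topol G) euclidean ch"
    and x: "x \<in> carrier (Kor G)"
  shows "ch x = 1"
proof -
  have "mat 1 1 (\<lambda>_. ch x) = 1\<^sub>m 1"
    using ordinary_rep_character[of G ch] assms by (auto simp: carrier_Kor[OF ts])
  then have "mat 1 1 (\<lambda>_. ch x) $$ (0, 0) = 1\<^sub>m 1 $$ (0, 0)" by (rule arg_cong)
  then show ?thesis by simp
qed

text \<open>Representations pull back along continuous homomorphisms, so Kor is functorial. Both its
  invariance under isomorphism and its behaviour under projections of a product rest on
  this.\<close>

lemma Kor_mono_hom:
  assumes "topspace (topol G) = carrier G" "topspace (topol H) = carrier H"
    and "\<phi> \<in> hom G H" "continuous_map (topol G) (topol H) \<phi>" "x \<in> carrier (Kor G)"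
  shows "\<phi> x \<in> carrier (Kor H)"
  using assms ordinary_rep_comp[of H _ _ \<phi> G]
  by (fastforce simp: carrier_Kor hom_def)

section \<open>Isomorphisms of topological groups\<close>

lemma topgroup_isoI:
  assumes "\<phi> \<in> hom G H" "\<psi> \<in> carrier H \<rightarrow> carrier G"
    and "\<And>x. x \<in> carrier G \<Longrightarrow> \<psi> (\<phi> x) = x" "\<And>y. y \<in> carrier H \<Longrightarrow> \<phi> (\<psi> y) = y"
    and "topspace (topol G) = carrier G" "topspace (topol H) = carrier H"
    and "continuous_map (topol G) (topol H) \<phi>" "continuous_map (topol H) (topol G) \<psi>"
  shows "G \<cong>\<^sub>t H"
proof -
  have "bij_betw \<phi> (carrier G) (carrier H)"
    by (rule bij_betwI[where g = \<psi>]) (use assms in \<open>auto simp: hom_def\<close>)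
  moreover have "homeomorphic_map (topol G) (topol H) \<phi>"
    by (rule homeomorphic_maps_map[THEN iffD1, THEN conjunct1, of _ _ _ \<psi>])
      (use assms in \<open>auto simp: homeomorphic_maps_def\<close>)
  ultimately show ?thesis
    using assms(1) by (auto simp: topgroup_iso_def iso_def)
qed

lemma topgroup_isoE:
  assumes "G \<cong>\<^sub>t H" "group G" "topspace (topol G) = carrier G" "topspace (topol H) = carrier H"
  obtains \<phi> \<psi> where "\<phi> \<in> hom G H" "\<psi> \<in> hom H G"
    "\<And>x. x \<in> carrier G \<Longrightarrow> \<psi> (\<phi> x) = x" "\<And>y. y \<in> carrier H \<Longrightarrow> \<phi> (\<psi> y) = y"
    "continuous_map (topol G) (topol H) \<phi>" "continuous_map (topol H) (topol G) \<psi>"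
proof -
  obtain \<phi> where \<phi>: "\<phi> \<in> iso G H" "homeomorphic_map (topol G) (topol H) \<phi>"
    using assms(1) by (auto simp: topgroup_iso_def)
  obtain \<psi> where \<psi>: "homeomorphic_maps (topol G) (topol H) \<phi> \<psi>"
    using \<phi>(2) homeomorphic_map_maps by blast
  then have inv: "\<And>x. x \<in> carrier G \<Longrightarrow> \<psi> (\<phi> x) = x" "\<And>y. y \<in> carrier H \<Longrightarrow> \<phi> (\<psi> y) = y"
    using assms by (auto simp: homeomorphic_maps_def)
  have cl: "\<psi> y \<in> carrier G" if "y \<in> carrier H" for y
    using \<psi> that assms by (auto simp: homeomorphic_maps_def continuous_map_def)
  have "\<psi> \<in> hom H G"
  proof (rule homI)
    fix x y assume xy: "x \<in> carrier H" "y \<in> carrier H"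
    have "\<phi> (\<psi> x \<otimes>\<^bsub>G\<^esub> \<psi> y) = x \<otimes>\<^bsub>H\<^esub> y"
      using \<phi>(1) cl xy inv by (auto simp: iso_def hom_def)
    then show "\<psi> (x \<otimes>\<^bsub>H\<^esub> y) = \<psi> x \<otimes>\<^bsub>G\<^esub> \<psi> y"
      using inv(1)[of "\<psi> x \<otimes>\<^bsub>G\<^esub> \<psi> y"] cl xy \<open>group G\<close>
      by (metis group.is_monoid monoid.m_closed)
  qed (rule cl)
  then show ?thesis
    using that[of \<phi> \<psi>] \<phi> \<psi> inv by (auto simp: iso_def homeomorphic_maps_def)
qed

lemma topgroup_iso_refl: "G \<cong>\<^sub>t G"
  using iso_set_refl[of G] homeomorphic_map_id[of "topol G" "topol G"]
  by (fastforce simp: topgroup_iso_def id_def)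

lemma topgroup_iso_trans: "G \<cong>\<^sub>t H \<Longrightarrow> H \<cong>\<^sub>t K \<Longrightarrow> G \<cong>\<^sub>t K"
  unfolding topgroup_iso_def by (blast intro: iso_set_trans homeomorphic_map_compose)

lemma topological_groupD:
  "topological_group G \<Longrightarrow> group G"
  "topological_group G \<Longrightarrow> topspace (topol G) = carrier G"
  by (auto simp: topological_group_def topological_group_axioms_def)

lemma topgroup_iso_sym:
  assumes "G \<cong>\<^sub>t H" "topological_group G" "topological_group H"
  shows "H \<cong>\<^sub>t G"
  by (rule topgroup_isoE[OF assms(1)], (simp_all add: topological_groupD assms)[3],
      rule topgroup_isoI) (use assms in \<open>auto simp: topological_groupD hom_def\<close>)

lemma topgroup_iso_Kor:
  assumes "G \<cong>\<^sub>t H" "topological_group G" "topological_group H"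
  shows "Kor G \<cong>\<^sub>t Kor H"
proof -
  note ts = assms(2,3)[THEN topological_groupD(2)]
  obtain \<phi> \<psi> where *: "\<phi> \<in> hom G H" "\<psi> \<in> hom H G"
    "\<And>x. x \<in> carrier G \<Longrightarrow> \<psi> (\<phi> x) = x" "\<And>y. y \<in> carrier H \<Longrightarrow> \<phi> (\<psi> y) = y"
    "continuous_map (topol G) (topol H) \<phi>" "continuous_map (topol H) (topol G) \<psi>"
    by (rule topgroup_isoE[OF assms(1)]) (use assms in \<open>auto simp: topological_groupD\<close>)
  have sub: "carrier (Kor G) \<subseteq> carrier G" "carrier (Kor H) \<subseteq> carrier H"
    by (auto simp: ts carrier_Kor)
  have im: "\<phi> x \<in> carrier (Kor H)" if "x \<in> carrier (Kor G)" for x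
    using Kor_mono_hom[of G H \<phi>] * ts that by auto
  have im': "\<psi> x \<in> carrier (Kor G)" if "x \<in> carrier (Kor H)" for x
    using Kor_mono_hom[of H G \<psi>] * ts that by auto
  show ?thesis
  proof (rule topgroup_isoI[of \<phi> _ _ \<psi>])
    show "\<phi> \<in> hom (Kor G) (Kor H)"
      using *(1) im sub by (auto simp: hom_def subset_eq)
    show "continuous_map (topol (Kor G)) (topol (Kor H)) \<phi>"
      using *(5) im by (auto simp: continuous_map_in_subtopology image_subset_iff
          intro: continuous_map_from_subtopology)
    show "continuous_map (topol (Kor H)) (topol (Kor G)) \<psi>"
      using *(6) im' by (auto simp: continuous_map_in_subtopology image_subset_iff
          intro: continuous_map_from_subtopology)
  qed (use * im' sub ts in auto)
qed

lemma topological_group_subset_Kor: "topological_group G \<Longrightarrow> carrier (Kor G) \<subseteq> carrier G"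
  by (auto simp: carrier_Kor topological_groupD)

section \<open>Continuity of the group operations and copies of a group on another type\<close>

lemma continuous_map_topgroup_mult:
  assumes "topological_group G" "continuous_map X (topol G) f" "continuous_map X (topol G) g"
  shows "continuous_map X (topol G) (\<lambda>x. f x \<otimes>\<^bsub>G\<^esub> g x)"
proof -
  have "continuous_map X (prod_topology (topol G) (topol G)) (\<lambda>x. (f x, g x))"
    using assms by (simp add: continuous_map_pairedI)
  from continuous_map_compose[OF this topological_group.continuous_mult[OF assms(1)]]
  show ?thesis by (simp add: o_def)
qed

lemma continuous_map_topgroup_inv:
  assumes "topological_group G" "continuous_map X (topol G) f"
  shows "continuous_map X (topol G) (\<lambda>x. inv\<^bsub>G\<^esub> f x)"
  using continuous_map_compose[OF assms(2) topological_group.continuous_inv[OF assms(1)]]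
  by (simp add: o_def)

text \<open>Lets a witness constructed on a product type be replaced by an isomorphic copy on a
  prescribed type.\<close>

lemma topgroup_transport:
  fixes f :: "'a \<Rightarrow> 'u"
  assumes H: "topological_group H" and inj: "inj_on f (carrier H)"
  obtains H' :: "'u topgroup" where "topological_group H'" "H \<cong>\<^sub>t H'"
proof -
  interpret H: topological_group H by (rule H)
  define C where "C = f ` carrier H"
  define g where "g = inv_into (carrier H) f"
  have gf [simp]: "g (f x) = x" if "x \<in> carrier H" for x
    using that inj by (simp add: g_def)
  have fC [simp]: "f x \<in> C" if "x \<in> carrier H" for x
    using that by (simp add: C_def)
  have gC [simp]: "g y \<in> carrier H" "f (g y) = y" if "y \<in> C" for y
    using that by (auto simp: C_def)
  \<comment> \<open>Operations and open sets are pulled back along the inverse \<open>g\<close>,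
    which makes \<open>f\<close> and \<open>g\<close> mutually inverse isomorphisms by
    construction.\<close>
  define H' :: "'u topgroup" where
    "H' = \<lparr>carrier = C, mult = (\<lambda>a b. f (g a \<otimes>\<^bsub>H\<^esub> g b)), one = f \<one>\<^bsub>H\<^esub>,
      topol = pullback_topology C g (topol H)\<rparr>"
  have H'_simps [simp]: "carrier H' = C" "\<And>a b. a \<otimes>\<^bsub>H'\<^esub> b = f (g a \<otimes>\<^bsub>H\<^esub> g b)"
    "\<one>\<^bsub>H'\<^esub> = f \<one>\<^bsub>H\<^esub>" "topol H' = pullback_topology C g (topol H)"
    by (simp_all add: H'_def)
  have "group H'"
  proof (rule groupI)
    fix x assume x: "x \<in> carrier H'"
    show "\<exists>y\<in>carrier H'. y \<otimes>\<^bsub>H'\<^esub> x = \<one>\<^bsub>H'\<^esub>"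
      by (rule bexI[of _ "f (inv\<^bsub>H\<^esub> g x)"]) (use x in auto)
  qed (auto simp: H.m_assoc)
  then interpret H': group H' .
  have inv': "inv\<^bsub>H'\<^esub> y = f (inv\<^bsub>H\<^esub> g y)" if "y \<in> C" for y
    by (rule H'.inv_equality) (use that in auto)
  have ts: "topspace (topol H') = C"
    by (auto simp: topspace_pullback_topology H.topspace_topol)
  have cg: "continuous_map (topol H') (topol H) g"
    using continuous_map_pullback[OF continuous_map_id[of "topol H"], of C g] by simp
  have cf: "continuous_map (topol H) (topol H') f"
    unfolding H'_simps
  proof (rule continuous_map_pullback')
    show "continuous_map (topol H) (topol H) (g \<circ> f)"
      by (rule continuous_map_eq[OF continuous_map_id]) (simp add: H.topspace_topol)
  qed (auto simp: H.topspace_topol)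
  have homeo: "homeomorphic_maps (topol H) (topol H') f g"
    using cf cg ts by (auto simp: homeomorphic_maps_def H.topspace_topol)
  have "topological_group H'"
  proof
    show "topspace (topol H') = carrier H'" using ts by simp
    show "Hausdorff_space (topol H')"
      using homeo H.Hausdorff_topol homeomorphic_Hausdorff_space homeomorphic_space_def by blast
    have "continuous_map (prod_topology (topol H') (topol H')) (topol H) (\<lambda>z. g (fst z) \<otimes>\<^bsub>H\<^esub> g (snd z))"
      by (intro continuous_map_topgroup_mult[OF H] continuous_map_compose[OF _ cg, unfolded o_def]
            continuous_map_fst continuous_map_snd)
    from continuous_map_compose[OF this cf]
    show "continuous_map (prod_topology (topol H') (topol H')) (topol H') (\<lambda>(x, y). x \<otimes>\<^bsub>H'\<^esub> y)"
      by (simp add: o_def case_prod_unfold)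
    have "continuous_map (topol H') (topol H) (\<lambda>y. inv\<^bsub>H\<^esub> g y)"
      by (rule continuous_map_topgroup_inv[OF H cg])
    from continuous_map_compose[OF this cf]
    show "continuous_map (topol H') (topol H') (\<lambda>x. inv\<^bsub>H'\<^esub> x)"
      by (rule continuous_map_eq) (simp add: inv' ts[simplified])
  qed
  moreover have "H \<cong>\<^sub>t H'"
    by (rule topgroup_isoI[of f _ _ g])
      (use cf cg ts in \<open>auto simp: hom_def H.topspace_topol\<close>)
  ultimately show thesis by (rule that)
qed

lemma topgroup_iso_locally_compact:
  "G \<cong>\<^sub>t H \<Longrightarrow> locally_compact_space (topol G) \<longleftrightarrow> locally_compact_space (topol H)"
  by (auto simp: topgroup_iso_def homeomorphic_map_imp_homeomorphic_space
      intro!: homeomorphic_locally_compact_space)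

text \<open>Since Kor respects isomorphism, a locally compact witness may live on any type; what
  counts is that its carrier injects into \<open>'u\<close>.\<close>

lemma Kor_class_LCG_I:
  assumes H: "topological_group H" "locally_compact_space (topol H)"
    and card: "carrier H \<lesssim> (UNIV :: 'u set)"
    and K: "topological_group K" "Kor H \<cong>\<^sub>t K" and KH: "topological_group (Kor H)"
  shows "K \<in> Kor_class (LCG :: 'u topgroup set)"
proof -
  obtain f :: "_ \<Rightarrow> 'u" where "inj_on f (carrier H)"
    using card by (auto simp: lepoll_def)
  from topgroup_transport[OF H(1) this]
  obtain H' :: "'u topgroup" where H': "topological_group H'" "H \<cong>\<^sub>t H'" .
  have "locally_compact_space (topol H')"
    using H'(2) H(2) topgroup_iso_locally_compact by blast
  moreover have "K \<cong>\<^sub>t Kor H'"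
    using topgroup_iso_trans[OF topgroup_iso_sym[OF K(2) KH K(1)] topgroup_iso_Kor[OF H'(2) H(1) H'(1)]] .
  ultimately show ?thesis
    using H' K by (auto simp: Kor_class_def LCG_def)
qed

section \<open>Kor as a closed topological subgroup\<close>

lemma topological_group_restrict:
  assumes G: "topological_group G" and K: "subgroup K G"
  shows "topological_group (restrict_topgroup G K)"
proof -
  interpret G: topological_group G by (rule G)
  have sub: "K \<subseteq> carrier G" using K subgroup.subset by blast
  have gr: "group (G\<lparr>carrier := K\<rparr>)" by (rule G.subgroup_imp_group[OF K])
  have gr': "group (restrict_topgroup G K)"
    by (rule groupI)
      (use gr in \<open>auto simp: restrict_topgroup_def subgroup.m_closed[OF K] subgroup.one_closed[OF K]
        subset_eq G.m_assoc subgroup.mem_carrier[OF K]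
        intro!: bexI[of _ "inv\<^bsub>G\<^esub> _"] subgroup.m_inv_closed[OF K]\<close>)
  interpret K: group "restrict_topgroup G K" by (rule gr')
  have iv: "inv\<^bsub>restrict_topgroup G K\<^esub> x = inv\<^bsub>G\<^esub> x" if "x \<in> K" for x
    by (rule K.inv_equality) (use that sub in \<open>auto simp: restrict_topgroup_def subgroup.m_inv_closed[OF K]\<close>)
  show ?thesis
  proof
    show ts: "topspace (topol (restrict_topgroup G K)) = carrier (restrict_topgroup G K)"
      using sub by (auto simp: restrict_topgroup_def G.topspace_topol)
    show "Hausdorff_space (topol (restrict_topgroup G K))"
      by (simp add: restrict_topgroup_def G.Hausdorff_topol Hausdorff_space_subtopology)
    show "continuous_map (prod_topology (topol (restrict_topgroup G K)) (topol (restrict_topgroup G K)))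
        (topol (restrict_topgroup G K)) (\<lambda>(x, y). x \<otimes>\<^bsub>restrict_topgroup G K\<^esub> y)"
      using continuous_map_from_subtopology[OF G.continuous_mult, of "K \<times> K"] subgroup.m_closed[OF K]
      by (auto simp: restrict_topgroup_def continuous_map_in_subtopology subtopology_Times
          G.topspace_topol)
    have "continuous_map (subtopology (topol G) K) (topol G) (\<lambda>x. inv\<^bsub>restrict_topgroup G K\<^esub> x)"
      by (rule continuous_map_eq[OF continuous_map_from_subtopology[OF G.continuous_inv]])
        (simp add: iv)
    then show "continuous_map (topol (restrict_topgroup G K)) (topol (restrict_topgroup G K))
        (\<lambda>x. inv\<^bsub>restrict_topgroup G K\<^esub> x)"
      using iv subgroup.m_inv_closed[OF K]
      by (auto simp: restrict_topgroup_def continuous_map_in_subtopology)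
  qed
qed

lemma subgroup_Kor:
  assumes G: "topological_group G"
  shows "subgroup (carrier (Kor G)) G"
proof -
  interpret G: topological_group G by (rule G)
  have inv: "\<rho> (inv\<^bsub>G\<^esub> x) = 1\<^sub>m n"
    if "ordinary_rep G n \<rho>" "x \<in> carrier G" "\<rho> x = 1\<^sub>m n" for x n \<rho>
  proof -
    interpret \<rho>: group_hom G "GL n" \<rho>
      by (rule group_hom_ordinary_rep[OF that(1) G.group_axioms])
    show ?thesis
      using \<rho>.hom_inv[OF that(2)] \<rho>.H.inv_one that(3) by (simp add: GL_simps)
  qed
  have mult: "\<rho> (x \<otimes>\<^bsub>G\<^esub> y) = 1\<^sub>m n"
    if "ordinary_rep G n \<rho>" "x \<in> carrier G" "y \<in> carrier G" "\<rho> x = 1\<^sub>m n" "\<rho> y = 1\<^sub>m n" for x y n \<rho>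
    using that by (simp add: ordinary_rep_mult[OF that(1)])
  have one: "\<one>\<^bsub>G\<^esub> \<in> carrier (Kor G)"
    by (simp add: carrier_Kor[OF G.topspace_topol] ordinary_rep_one[OF _ G.group_axioms])
  show ?thesis
    by (rule G.subgroupI) (use one mult inv in \<open>auto simp: carrier_Kor[OF G.topspace_topol]\<close>)
qed

lemma Kor_eq_restrict: "Kor G = restrict_topgroup G (carrier (Kor G))"
  by (simp add: Kor_def restrict_topgroup_def)

lemma topological_group_Kor: "topological_group G \<Longrightarrow> topological_group (Kor G)"
  by (subst Kor_eq_restrict) (rule topological_group_restrict[OF _ subgroup_Kor])

text \<open>The kernel is cut out by finitely many equations between continuous matrix entries and
  constants, and each of them defines a closed set.\<close>

lemma closedin_ordinary_rep_kernel:
  assumes G: "topological_group G" and rep: "ordinary_rep G n \<rho>"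
  shows "closedin (topol G) {x \<in> carrier G. \<rho> x = 1\<^sub>m n}"
proof -
  have eq: "{x \<in> carrier G. \<rho> x = 1\<^sub>m n} =
      topspace (topol G) \<inter> (\<Inter>(i, j)\<in>{..<n} \<times> {..<n}.
        {x \<in> topspace (topol G). \<rho> x $$ (i, j) \<in> {1\<^sub>m n $$ (i, j)}})"
    using ordinary_rep_carrier_mat[OF rep, THEN carrier_matD(1)]
      ordinary_rep_carrier_mat[OF rep, THEN carrier_matD(2)]
    by (auto simp: topological_groupD[OF G] intro!: eq_matI)
  have c: "closedin (topol G) {x \<in> topspace (topol G). \<rho> x $$ (i, j) \<in> {1\<^sub>m n $$ (i, j)}}"
    if "i < n" "j < n" for i j
    by (rule closedin_continuous_map_preimage[OF ordinary_rep_entry_continuous[OF rep that]]) simp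
  show ?thesis
    unfolding eq
    by (cases "n = 0") (auto intro!: closedin_Int closedin_INT c[simplified singleton_iff] simp del: index_one_mat)
qed

lemma closedin_Kor:
  assumes G: "topological_group G"
  shows "closedin (topol G) (carrier (Kor G))"
proof -
  have "carrier (Kor G) =
      \<Inter>{{x \<in> carrier G. \<rho> x = 1\<^sub>m n} | n \<rho>. ordinary_rep G n \<rho>}"
    using ordinary_rep_trivial[OF topological_groupD(2)[OF G]]
    by (auto simp: carrier_Kor topological_groupD[OF G])
  moreover have "closedin (topol G) \<dots>"
    by (rule closedin_Inter)
      (use closedin_ordinary_rep_kernel[OF G] ordinary_rep_trivial[OF topological_groupD(2)[OF G]] in auto)
  ultimately show ?thesis by simp
qed

lemma locally_compact_Kor:
  assumes "topological_group G" "locally_compact_space (topol G)"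
  shows "locally_compact_space (topol (Kor G))"
  using locally_compact_space_closed_subset[OF assms(2) closedin_Kor[OF assms(1)]] by simp

section \<open>The general linear group has no small subgroups\<close>

text \<open>This norm is chosen because it is submultiplicative and because its continuity along a
  representation is immediate from that of the entries.\<close>

definition mat_norm :: "nat \<Rightarrow> complex mat \<Rightarrow> real"
  where "mat_norm n A = (\<Sum>i<n. \<Sum>j<n. cmod (A $$ (i, j)))"

lemma mat_norm_mult:
  assumes A: "A \<in> carrier_mat n n" and B: "B \<in> carrier_mat n n"
  shows "mat_norm n (A * B) \<le> mat_norm n A * mat_norm n B"
proof -
  have "mat_norm n (A * B) = (\<Sum>i<n. \<Sum>j<n. cmod (\<Sum>k<n. A $$ (i, k) * B $$ (k, j)))"
    using A B by (simp add: mat_norm_def scalar_prod_def atLeast0LessThan)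
  also have "\<dots> \<le> (\<Sum>i<n. \<Sum>j<n. \<Sum>k<n. cmod (A $$ (i, k)) * cmod (B $$ (k, j)))"
    by (intro sum_mono order.trans[OF norm_sum]) (simp add: norm_mult)
  also have "\<dots> = (\<Sum>i<n. \<Sum>k<n. cmod (A $$ (i, k)) * (\<Sum>j<n. cmod (B $$ (k, j))))"
    by (subst sum.swap) (simp add: sum_distrib_left)
  also have "\<dots> \<le> (\<Sum>i<n. \<Sum>k<n. cmod (A $$ (i, k)) * mat_norm n B)"
    by (intro sum_mono mult_left_mono)
      (auto simp: mat_norm_def intro!: member_le_sum sum_nonneg)
  also have "\<dots> = mat_norm n A * mat_norm n B"
    by (simp add: mat_norm_def sum_distrib_right)
  finally show ?thesis .
qed

text \<open>With \<open>D = g - 1\<close> one has \<open>g * g - 1 = 2 D + D * D\<close>, so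
  squaring almost doubles the distance from the identity as long as that distance is small.\<close>

lemma mat_norm_square:
  assumes g: "g \<in> carrier_mat n n"
  shows "2 * mat_norm n (g - 1\<^sub>m n) - (mat_norm n (g - 1\<^sub>m n))\<^sup>2 \<le> mat_norm n (g * g - 1\<^sub>m n)"
proof -
  define D where "D = g - 1\<^sub>m n"
  have D: "D \<in> carrier_mat n n" using g by (auto simp: D_def)
  have "g = 1\<^sub>m n + D" using g by (auto simp: D_def)
  then have "g * g = 1\<^sub>m n * (1\<^sub>m n + D) + D * (1\<^sub>m n + D)"
    using D add_mult_distrib_mat[of "1\<^sub>m n" n n D "1\<^sub>m n + D" n] by simp
  then have gg: "g * g = 1\<^sub>m n + D + (D + D * D)"
    using D mult_add_distrib_mat[of D n n "1\<^sub>m n" n D] by simp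
  have e: "2 * cmod (D $$ (i, j)) - cmod ((D * D) $$ (i, j)) \<le> cmod ((g * g - 1\<^sub>m n) $$ (i, j))"
    if "i < n" "j < n" for i j
  proof -
    have "(g * g - 1\<^sub>m n) $$ (i, j) = 2 * D $$ (i, j) + (D * D) $$ (i, j)"
      using that D by (simp add: gg del: index_mult_mat(1))
    then show ?thesis
      using norm_triangle_ineq2[of "2 * D $$ (i, j)" "- (D * D) $$ (i, j)"]
      by (simp add: norm_mult)
  qed
  have "2 * mat_norm n D - mat_norm n (D * D) \<le> mat_norm n (g * g - 1\<^sub>m n)"
    unfolding mat_norm_def sum_distrib_left sum_subtractf[symmetric]
    by (intro sum_mono e) auto
  then show ?thesis
    using mat_norm_mult[OF D D] by (simp add: D_def power2_eq_square)
qed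

text \<open>Repeated squaring inside a subgroup contained in \<open>U\<close> would multiply a
  nonzero distance from the identity by at least 3/2 each time, and so eventually leave
  \<open>U\<close>.\<close>

lemma ordinary_rep_no_small_subgroups:
  assumes G: "topological_group G" and rep: "ordinary_rep G n \<rho>"
  obtains U where "openin (topol G) U" "\<one>\<^bsub>G\<^esub> \<in> U"
    "\<And>L x. subgroup L G \<Longrightarrow> L \<subseteq> U \<Longrightarrow> x \<in> L \<Longrightarrow> \<rho> x = 1\<^sub>m n"
proof -
  interpret G: topological_group G by (rule G)
  define N where "N x = mat_norm n (\<rho> x - 1\<^sub>m n)" for x
  define U where "U = {x \<in> topspace (topol G). N x \<in> {..<1/2}}"
  have car: "\<rho> x \<in> carrier_mat n n" if "x \<in> carrier G" for x
    using ordinary_rep_carrier_mat[OF rep that] .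
  have "continuous_map (topol G) euclidean
      (\<lambda>x. \<Sum>i<n. \<Sum>j<n. cmod (\<rho> x $$ (i, j) - 1\<^sub>m n $$ (i, j)))"
    by (intro continuous_map_sum continuous_map_norm continuous_map_diff
        ordinary_rep_entry_continuous[OF rep]) auto
  then have "continuous_map (topol G) euclidean N"
    by (rule continuous_map_eq)
      (use car in \<open>auto simp: N_def mat_norm_def G.topspace_topol intro!: sum.cong\<close>)
  then have "openin (topol G) U"
    unfolding U_def by (rule openin_continuous_map_preimage) simp
  moreover have "\<one>\<^bsub>G\<^esub> \<in> U"
    using ordinary_rep_one[OF rep G.group_axioms]
    by (simp add: U_def N_def mat_norm_def G.topspace_topol)
  moreover have "\<rho> x = 1\<^sub>m n" if L: "subgroup L G" and LU: "L \<subseteq> U" and x: "x \<in> L" for L x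
  proof -
    have LG: "L \<subseteq> carrier G" using L subgroup.subset by blast
    have small: "N y < 1/2" if "y \<in> L" for y using that LU by (auto simp: U_def)
    have grow: "\<exists>y\<in>L. (3/2)^k * N x \<le> N y" for k
    proof (induction k)
      case 0 show ?case using x by auto
    next
      case (Suc k)
      then obtain y where y: "y \<in> L" "(3/2)^k * N x \<le> N y" by blast
      have yG: "y \<in> carrier G" using y LG by blast
      have N0: "0 \<le> N y" by (auto simp: N_def mat_norm_def intro!: sum_nonneg)
      \<comment> \<open>Here the bound 1/2 in \<open>U\<close> is used: \<open>t < 1/2\<close> gives
        \<open>t * t \<le> t / 2\<close>, whence \<open>2 t - t * t \<ge> 3/2 t\<close>.\<close>
      have "3/2 * N y \<le> 2 * N y - (N y)\<^sup>2"
        using mult_right_mono[of "N y" "1/2" "N y"] small[OF y(1)] N0 by (simp add: power2_eq_square)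
      also have "\<dots> \<le> N (y \<otimes>\<^bsub>G\<^esub> y)"
        using mat_norm_square[OF car[OF yG]] ordinary_rep_mult[OF rep yG yG] by (simp add: N_def)
      finally have "(3/2)^(Suc k) * N x \<le> N (y \<otimes>\<^bsub>G\<^esub> y)" using y(2) by simp
      then show ?case using subgroup.m_closed[OF L y(1) y(1)] by blast
    qed
    have "N x = 0"
    proof (rule ccontr)
      assume "N x \<noteq> 0"
      then have pos: "N x > 0"
        using sum_nonneg[of "{..<n}"] by (simp add: N_def mat_norm_def sum_nonneg order_less_le)
      obtain k where "1 / (2 * N x) < (3/2 :: real) ^ k"
        using real_arch_pow[of "3/2"] by auto
      then have "1/2 < (3/2)^k * N x" using pos by (simp add: field_simps)
      with grow[of k] small show False by force
    qed
    then have "\<forall>i<n. \<forall>j<n. (\<rho> x - 1\<^sub>m n) $$ (i, j) = 0"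
      by (simp add: N_def mat_norm_def sum_nonneg_eq_0_iff sum_nonneg)
    then show ?thesis
      using car[of x] x LG by (intro eq_matI) auto
  qed
  ultimately show thesis by (rule that)
qed

text \<open>Gaussian elimination by induction on the coordinates: a vector \<open>y j0\<close> with
  nonzero entry at \<open>b\<close> serves as pivot, and clearing the entry at \<open>b\<close> of
  the other vectors leaves one vector and one coordinate fewer.\<close>

lemma exists_linear_dependence:
  fixes y :: "'j \<Rightarrow> 'b \<Rightarrow> 'f::field"
  assumes "finite B" "finite J" "card B < card J"
  shows "\<exists>c. (\<exists>j\<in>J. c j \<noteq> 0) \<and> (\<forall>b\<in>B. (\<Sum>j\<in>J. c j * y j b) = 0)"
  using assms
proof (induction B arbitrary: J y rule: finite_induct)
  case empty
  then have "J \<noteq> {}" by auto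
  then show ?case by (auto intro!: exI[of _ "\<lambda>_. 1"])
next
  case (insert b B)
  show ?case
  proof (cases "\<forall>j\<in>J. y j b = 0")
    case True
    have "card B < card J" using insert by simp
    from insert.IH[OF insert.prems(1) this, of y] show ?thesis using True by auto
  next
    case False
    then obtain j0 where j0: "j0 \<in> J" "y j0 b \<noteq> 0" by blast
    define J' where "J' = J - {j0}"
    have J': "finite J'" "card B < card J'" "J = insert j0 J'" "j0 \<notin> J'"
      using insert j0 by (auto simp: J'_def card_Diff_singleton)
    obtain c where c: "\<exists>j\<in>J'. c j \<noteq> 0"
      "\<And>b'. b' \<in> B \<Longrightarrow> (\<Sum>j\<in>J'. c j * (y j b' - y j b / y j0 b * y j0 b')) = 0"
      using insert.IH[OF J'(1,2), of "\<lambda>j b'. y j b' - y j b / y j0 b * y j0 b'"] by blast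
    \<comment> \<open>The pivot coefficient is forced by the vanishing of coordinate
      \<open>b\<close>; the remaining coordinates then vanish by the relation between the reduced
      vectors.\<close>
    define d where "d = c(j0 := - (\<Sum>j\<in>J'. c j * y j b) / y j0 b)"
    have sum: "(\<Sum>j\<in>J. d j * y j b') = d j0 * y j0 b' + (\<Sum>j\<in>J'. c j * y j b')" for b'
      using J' by (auto simp: d_def intro!: sum.cong)
    have "(\<Sum>j\<in>J. d j * y j b') = 0" if "b' \<in> insert b B" for b'
    proof (cases "b' = b")
      case True
      show ?thesis unfolding True sum by (simp add: d_def j0)
    next
      case False
      have "(\<Sum>j\<in>J'. c j * y j b') - (\<Sum>j\<in>J'. c j * y j b) / y j0 b * y j0 b' = 0"
        using c(2)[of b'] that False
        by (simp add: right_diff_distrib sum_subtractf sum_distrib_right sum_divide_distrib mult.assoc)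
      then show ?thesis unfolding sum by (simp add: d_def)
    qed
    moreover have "\<exists>j\<in>J. d j \<noteq> 0"
      using c(1) J' by (auto simp: d_def)
    ultimately show ?thesis by blast
  qed
qed

text \<open>The matrices \<open>Y j\<close> with \<open>j \<le> n\<^sup>2\<close> are linearly dependent, and commuting with \<open>X k\<close> isolates
  the \<open>k\<close>-th coefficient of a linear relation.\<close>

lemma exists_commuting_pair:
  fixes X Y :: "nat \<Rightarrow> 'f::field mat"
  assumes X: "\<And>i. X i \<in> carrier_mat n n" and Y: "\<And>i. Y i \<in> carrier_mat n n"
    and comm: "\<And>i j. i \<noteq> j \<Longrightarrow> X i * Y j = Y j * X i"
  shows "\<exists>k. X k * Y k = Y k * X k"
proof -
  \<comment> \<open>\<open>?J\<close> has one index more than an \<open>n\<close> by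
    \<open>n\<close> matrix has entries.\<close>
  let ?B = "{..<n} \<times> {..<n}" and ?J = "{..n * n}"
  obtain c k where k: "k \<in> ?J" "c k \<noteq> 0"
    and c: "\<And>b. b \<in> ?B \<Longrightarrow> (\<Sum>j\<in>?J. c j * Y j $$ b) = 0"
    using exists_linear_dependence[of ?B ?J "\<lambda>j b. Y j $$ b"] by auto
  have XY: "(X k * Y j) $$ (p, q) = (\<Sum>l<n. X k $$ (p, l) * Y j $$ (l, q))"
    and YX: "(Y j * X k) $$ (p, q) = (\<Sum>l<n. Y j $$ (p, l) * X k $$ (l, q))"
    if "p < n" "q < n" for p q j
    using X[of k] Y[of j] that by (auto simp: scalar_prod_def atLeast0LessThan)
  have "X k * Y k = Y k * X k"
  proof (rule eq_matI)
    fix p q assume "p < dim_row (Y k * X k)" "q < dim_col (Y k * X k)"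
    then have pq: "p < n" "q < n" using X[of k] Y[of k] by auto
    \<comment> \<open>Multiplication by \<open>X k\<close> is linear, so it sends the vanishing
      combination of the \<open>Y j\<close> to zero, from the left and likewise from the
      right.\<close>
    have "(\<Sum>j\<in>?J. c j * (X k * Y j) $$ (p, q)) = (\<Sum>l<n. X k $$ (p, l) * (\<Sum>j\<in>?J. c j * Y j $$ (l, q)))"
      unfolding XY[OF pq] sum_distrib_left by (subst sum.swap) (simp add: mult_ac)
    also have "\<dots> = 0" using c pq by simp
    finally have 1: "(\<Sum>j\<in>?J. c j * (X k * Y j) $$ (p, q)) = 0" .
    have "(\<Sum>j\<in>?J. c j * (Y j * X k) $$ (p, q)) = (\<Sum>l<n. X k $$ (l, q) * (\<Sum>j\<in>?J. c j * Y j $$ (p, l)))"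
      unfolding YX[OF pq] sum_distrib_left by (subst sum.swap) (simp add: mult_ac)
    also have "\<dots> = 0" using c pq by simp
    finally have "(\<Sum>j\<in>?J. c j * ((X k * Y j) $$ (p, q) - (Y j * X k) $$ (p, q))) = 0"
      using 1 by (simp add: right_diff_distrib sum_subtractf)
    also have "(\<Sum>j\<in>?J. c j * ((X k * Y j) $$ (p, q) - (Y j * X k) $$ (p, q)))
        = c k * ((X k * Y k) $$ (p, q) - (Y k * X k) $$ (p, q))"
      using k comm by (subst sum.remove[of _ k]) (auto intro!: sum.neutral)
    finally show "(X k * Y k) $$ (p, q) = (Y k * X k) $$ (p, q)" using k by simp
  qed (use X[of k] Y[of k] in auto)
  then show ?thesis by blast
qed

section \<open>Cardinalities\<close>

lemma times_lepoll_infinite: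
  assumes "infinite (UNIV :: 'u set)" "A \<lesssim> (UNIV :: 'u set)" "B \<lesssim> (UNIV :: 'u set)"
  shows "A \<times> B \<lesssim> (UNIV :: 'u set)"
proof -
  have "A \<times> B \<lesssim> (UNIV :: 'u set) \<times> (UNIV :: 'u set)"
    using assms times_lepoll_mono by blast
  also have "\<dots> \<approx> (UNIV :: 'u set)"
    using assms(1) card_of_Times_same_infinite eqpoll_iff_card_of_ordIso by blast
  finally show ?thesis .
qed

lemma countable_lepoll_infinite:
  assumes "infinite (UNIV :: 'u set)"
  shows "(UNIV :: 'c::countable set) \<lesssim> (UNIV :: 'u set)"
proof -
  have "(UNIV :: 'c set) \<lesssim> (UNIV :: nat set)"
    using inj_to_nat by (auto simp: lepoll_def)
  also have "\<dots> \<lesssim> (UNIV :: 'u set)"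
    using assms infinite_le_lepoll by blast
  finally show ?thesis .
qed

text \<open>A finitely supported function is determined by its finite graph over the support, and an
  infinite set has as many finite subsets as elements.\<close>

lemma poly_mapping_lepoll_infinite:
  assumes "infinite (UNIV :: 'u set)" "(UNIV :: 'k set) \<lesssim> (UNIV :: 'u set)"
  shows "(UNIV :: ('k \<Rightarrow>\<^sub>0 int) set) \<lesssim> (UNIV :: 'u set)"
proof -
  define graph :: "('k \<Rightarrow>\<^sub>0 int) \<Rightarrow> ('k \<times> int) set"
    where "graph x = (\<lambda>k. (k, Poly_Mapping.lookup x k)) ` Poly_Mapping.keys x" for x
  have "inj graph"
  proof (rule injI)
    fix x y assume "graph x = graph y"
    then have "Poly_Mapping.lookup x k = v \<and> v \<noteq> 0 \<longleftrightarrow> Poly_Mapping.lookup y k = v \<and> v \<noteq> 0" for k v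
      by (auto simp: graph_def set_eq_iff image_iff in_keys_iff)
    then show "x = y" by (metis poly_mapping_eqI)
  qed
  then have "(UNIV :: ('k \<Rightarrow>\<^sub>0 int) set) \<lesssim> Fpow (UNIV :: ('k \<times> int) set)"
    by (auto simp: lepoll_def graph_def Fpow_def intro!: exI[of _ graph])
  also have "\<dots> \<approx> (UNIV :: ('k \<times> int) set)"
    by (rule eqpoll_Fpow) (simp add: finite_prod)
  also have "(UNIV :: ('k \<times> int) set) \<lesssim> (UNIV :: 'u set)"
    using times_lepoll_infinite[OF assms countable_lepoll_infinite[OF assms(1)], where ?'c1 = int] by simp
  finally show ?thesis .
qed

section \<open>Heisenberg groups over abelian groups\<close>

text \<open>The free abelian group on a basis containing infinitely many vectors
  \<open>(i, s)\<close> for each \<open>s\<close>; the index \<open>i\<close> supplies the unlimited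
  number of commuting pairs.\<close>

type_synonym 'a gens = "(nat \<times> 'a) \<Rightarrow>\<^sub>0 int"

text \<open>The number 2 has infinite order in the multiplicative group, as absolute values show;
  thus the characters built from it detect integers.\<close>

lemma two_powi_eq_1:
  assumes "(2::complex) powi m = 1"
  shows "m = 0"
proof -
  have "norm ((2::complex) powi m) = 1" using assms by simp
  then have "(2::real) powi m = 1" by (simp add: norm_power_int)
  then show "m = 0"
    using power_int_strict_increasing[of 0 m "2::real"] power_int_strict_increasing[of m 0 "2::real"]
    by (cases m "0::int" rule: linorder_cases) auto
qed

text \<open>The bilinear pairing with values in \<open>A\<close> that sends two equal basis vectors \<open>(i, s)\<close> to
  \<open>s\<close> and two distinct ones to the identity.\<close>

definition heis_pair :: "'a topgroup \<Rightarrow> 'a gens \<Rightarrow> 'a gens \<Rightarrow> 'a"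
  where "heis_pair A x y =
    finprod A (\<lambda>k. (if snd k \<in> carrier A then snd k else \<one>\<^bsub>A\<^esub>)
      [^]\<^bsub>A\<^esub> (Poly_Mapping.lookup x k * Poly_Mapping.lookup y k)) (Poly_Mapping.keys x)"

text \<open>The central extension of \<open>'a gens \<times> 'a gens\<close> by \<open>A\<close>
  with cocycle \<open>heis_pair A\<close>, an analogue of upper unitriangular 3 by 3 matrices. The
  quotient is discrete, so \<open>A\<close> sits inside as an open central subgroup.\<close>

definition heisenberg :: "'a topgroup \<Rightarrow> ('a \<times> 'a gens \<times> 'a gens) topgroup"
  where "heisenberg A =
    \<lparr>carrier = carrier A \<times> UNIV,
     mult = (\<lambda>(a, x, y) (b, x', y'). (a \<otimes>\<^bsub>A\<^esub> b \<otimes>\<^bsub>A\<^esub> heis_pair A x y', x + x', y + y')),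
     one = (\<one>\<^bsub>A\<^esub>, 0, 0),
     topol = prod_topology (topol A) (discrete_topology UNIV)\<rparr>"

locale abelian_topgroup = comm_group A + topological_group A for A :: "'a topgroup" (structure)
begin

text \<open>Indices outside the support contribute identity factors. This permits a common index set
  for \<open>x\<close>, \<open>x'\<close> and \<open>x + x'\<close>, whose supports differ;
  additivity in the left argument needs it.\<close>

lemma heis_pair_superset:
  assumes "finite S" "Poly_Mapping.keys x \<subseteq> S"
  shows "heis_pair A x y = finprod A (\<lambda>k. (if snd k \<in> carrier A then snd k else \<one>)
      [^] (Poly_Mapping.lookup x k * Poly_Mapping.lookup y k)) S"
  unfolding heis_pair_def
  by (rule finprod_mono_neutral_cong_left) (use assms in \<open>auto simp: in_keys_iff\<close>)

lemma heis_pair_closed [simp]: "heis_pair A x y \<in> carrier A"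
  unfolding heis_pair_def by (rule finprod_closed) auto

lemma heis_pair_add_right: "heis_pair A x (y + y') = heis_pair A x y \<otimes> heis_pair A x y'"
  unfolding heis_pair_def
  by (subst finprod_multf[symmetric]) (auto simp: lookup_add distrib_left int_pow_mult intro!: finprod_cong')

lemma heis_pair_add_left: "heis_pair A (x + x') y = heis_pair A x y \<otimes> heis_pair A x' y"
proof -
  let ?S = "Poly_Mapping.keys x \<union> Poly_Mapping.keys x'"
  have S: "finite ?S" "Poly_Mapping.keys x \<subseteq> ?S" "Poly_Mapping.keys x' \<subseteq> ?S"
    "Poly_Mapping.keys (x + x') \<subseteq> ?S"
    using keys_add[of x x'] by auto
  show ?thesis
    unfolding heis_pair_superset[OF S(1,2)] heis_pair_superset[OF S(1,3)] heis_pair_superset[OF S(1,4)]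
    by (subst finprod_multf[symmetric]) (auto simp: lookup_add distrib_right int_pow_mult intro!: finprod_cong')
qed

lemma heis_pair_zero [simp]: "heis_pair A 0 y = \<one>" "heis_pair A x 0 = \<one>"
  by (simp_all add: heis_pair_def)

lemma heis_pair_minus [simp]: "heis_pair A x (- y) = inv (heis_pair A x y)"
    "heis_pair A (- x) y = inv (heis_pair A x y)"
  using heis_pair_add_right[of x "- y" y] heis_pair_add_left[of "- x" x y]
  by (auto intro!: inv_equality[symmetric])

lemma heis_pair_single:
  assumes "s \<in> carrier A"
  shows "heis_pair A (Poly_Mapping.single (i, s) 1) (Poly_Mapping.single (j, s) 1)
    = (if i = j then s else \<one>)"
  using assms by (simp add: heis_pair_def lookup_single when_def)

lemma heis_simps:
  "carrier (heisenberg A) = carrier A \<times> UNIV"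
  "(a, x, y) \<otimes>\<^bsub>heisenberg A\<^esub> (b, x', y') = (a \<otimes> b \<otimes> heis_pair A x y', x + x', y + y')"
  "\<one>\<^bsub>heisenberg A\<^esub> = (\<one>, 0, 0)"
  "topol (heisenberg A) = prod_topology (topol A) (discrete_topology UNIV)"
  by (simp_all add: heisenberg_def)

lemma group_heisenberg: "group (heisenberg A)"
proof (rule groupI)
  fix u v w assume "u \<in> carrier (heisenberg A)" "v \<in> carrier (heisenberg A)" "w \<in> carrier (heisenberg A)"
  then obtain a x y b x' y' c x'' y''
    where "u = (a, x, y)" "v = (b, x', y')" "w = (c, x'', y'')"
      "a \<in> carrier A" "b \<in> carrier A" "c \<in> carrier A"
    by (auto simp: heis_simps)
  then show "u \<otimes>\<^bsub>heisenberg A\<^esub> v \<otimes>\<^bsub>heisenberg A\<^esub> w = u \<otimes>\<^bsub>heisenberg A\<^esub> (v \<otimes>\<^bsub>heisenberg A\<^esub> w)"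
    by (simp add: heis_simps heis_pair_add_left heis_pair_add_right add.assoc m_ac)
next
  fix u assume "u \<in> carrier (heisenberg A)"
  then obtain a x y where u: "u = (a, x, y)" "a \<in> carrier A"
    by (auto simp: heis_simps)
  then have "inv a \<otimes> heis_pair A x y \<otimes> a \<otimes> inv (heis_pair A x y) = \<one>"
    by (metis heis_pair_closed inv_closed l_inv m_assoc m_comm r_inv r_one)
  then show "\<exists>v\<in>carrier (heisenberg A). v \<otimes>\<^bsub>heisenberg A\<^esub> u = \<one>\<^bsub>heisenberg A\<^esub>"
    \<comment> \<open>The factor \<open>heis_pair A x y\<close> in the inverse compensates the
      cocycle value \<open>heis_pair A (- x) y\<close>, which is its inverse.\<close>
    using u by (intro bexI[of _ "(inv a \<otimes> heis_pair A x y, - x, - y)"]) (auto simp: heis_simps)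
qed (auto simp: heis_simps)

lemma inv_heisenberg:
  assumes "a \<in> carrier A"
  shows "inv\<^bsub>heisenberg A\<^esub> (a, x, y) = (inv a \<otimes> heis_pair A x y, - x, - y)"
proof (rule group.inv_equality[OF group_heisenberg])
  have "inv a \<otimes> heis_pair A x y \<otimes> a \<otimes> inv (heis_pair A x y) = \<one>"
    using assms by (metis heis_pair_closed inv_closed l_inv m_assoc m_comm r_inv r_one)
  then show "(inv a \<otimes> heis_pair A x y, - x, - y) \<otimes>\<^bsub>heisenberg A\<^esub> (a, x, y) = \<one>\<^bsub>heisenberg A\<^esub>"
    by (simp add: heis_simps)
qed (use assms in \<open>auto simp: heis_simps\<close>)

lemma is_topological_group: "topological_group A"
  by unfold_locales

text \<open>The cocycle depends only on the discrete components, and every function of those is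
  continuous; what remains is continuity in \<open>A\<close>.\<close>

lemma topological_group_heisenberg: "topological_group (heisenberg A)"
proof -
  let ?H = "heisenberg A"
  let ?D = "discrete_topology UNIV :: ('a gens \<times> 'a gens) topology"
  interpret H: group ?H by (rule group_heisenberg)
  have ts: "topspace (topol ?H) = carrier ?H"
    by (simp add: heis_simps topspace_topol)
  have fst: "continuous_map X (topol A) (\<lambda>z. fst (f z))" if "continuous_map X (topol ?H) f" for X and f :: "'z \<Rightarrow> _"
    using continuous_map_compose[OF that[unfolded heis_simps] continuous_map_fst] by (simp add: o_def)
  have snd: "continuous_map X ?D (\<lambda>z. snd (f z))" if "continuous_map X (topol ?H) f" for X and f :: "'z \<Rightarrow> _"
    using continuous_map_compose[OF that[unfolded heis_simps] continuous_map_snd] by (simp add: o_def)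
  show ?thesis
  proof
    show "topspace (topol ?H) = carrier ?H" by (rule ts)
    show "Hausdorff_space (topol ?H)"
      by (simp add: heis_simps Hausdorff_space_prod_topology Hausdorff_topol)
    let ?HH = "prod_topology (topol ?H) (topol ?H)"
    have s: "continuous_map ?HH (prod_topology ?D ?D) (\<lambda>z. (snd (fst z), snd (snd z)))"
      by (intro continuous_map_pairedI snd continuous_map_fst continuous_map_snd)
    then have s: "continuous_map ?HH (discrete_topology UNIV) (\<lambda>z. (snd (fst z), snd (snd z)))"
      by (simp add: prod_topology_discrete_topology[symmetric])
    have d: "continuous_map ?HH Y (\<lambda>z. g (snd (fst z), snd (snd z)))"
      if "\<And>z. g z \<in> topspace Y" for Y and g :: "_ \<Rightarrow> 'y"
      using continuous_map_compose[OF s, of Y g] that by (simp add: o_def)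
    have "continuous_map ?HH (topol ?H) (\<lambda>z. (fst (fst z) \<otimes> fst (snd z) \<otimes>
        heis_pair A (fst (snd (fst z))) (snd (snd (snd z))),
        (fst (snd (fst z)) + fst (snd (snd z)), snd (snd (fst z)) + snd (snd (snd z)))))"
      unfolding heis_simps(4)
    proof (intro continuous_map_pairedI continuous_map_topgroup_mult[OF is_topological_group])
      show "continuous_map (prod_topology (prod_topology (topol A) ?D) (prod_topology (topol A) ?D))
          (topol A) (\<lambda>z. heis_pair A (fst (snd (fst z))) (snd (snd (snd z))))"
        using d[of "\<lambda>w. heis_pair A (fst (fst w)) (snd (snd w))" "topol A"]
        by (simp add: heis_simps topspace_topol)
      show "continuous_map (prod_topology (prod_topology (topol A) ?D) (prod_topology (topol A) ?D)) ?D
          (\<lambda>z. (fst (snd (fst z)) + fst (snd (snd z)), snd (snd (fst z)) + snd (snd (snd z))))"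
        using d[of "\<lambda>(p, q). (fst p + fst q, snd p + snd q)" ?D]
        by (simp add: heis_simps)
    qed (use fst[OF continuous_map_fst] fst[OF continuous_map_snd] in \<open>simp_all add: heis_simps\<close>)
    then show "continuous_map ?HH (topol ?H) (\<lambda>(u, v). u \<otimes>\<^bsub>?H\<^esub> v)"
      by (simp add: case_prod_unfold heisenberg_def)
    have s: "continuous_map (topol ?H) ?D snd"
      by (simp add: heis_simps continuous_map_snd)
    have d: "continuous_map (topol ?H) Y (\<lambda>z. g (snd z))"
      if "\<And>z. g z \<in> topspace Y" for Y and g :: "_ \<Rightarrow> 'y"
      using continuous_map_compose[OF s, of Y g] that by (simp add: o_def)
    have "continuous_map (topol ?H) (topol ?H) (\<lambda>z. (inv (fst z) \<otimes>
        heis_pair A (fst (snd z)) (snd (snd z)), (- fst (snd z), - snd (snd z))))"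
      unfolding heis_simps(4)
    proof (intro continuous_map_pairedI continuous_map_topgroup_mult[OF is_topological_group]
        continuous_map_topgroup_inv[OF is_topological_group])
      show "continuous_map (prod_topology (topol A) ?D) (topol A)
          (\<lambda>z. heis_pair A (fst (snd z)) (snd (snd z)))"
        using d[of "\<lambda>p. heis_pair A (fst p) (snd p)" "topol A"]
        by (simp add: heis_simps topspace_topol)
      show "continuous_map (prod_topology (topol A) ?D) ?D (\<lambda>z. (- fst (snd z), - snd (snd z)))"
        using d[of "\<lambda>p. (- fst p, - snd p)" ?D]
        by (simp add: heis_simps)
    qed (rule continuous_map_fst)
    then show "continuous_map (topol ?H) (topol ?H) (\<lambda>u. inv\<^bsub>?H\<^esub> u)"
      by (rule continuous_map_eq) (auto simp: ts inv_heisenberg heis_simps topspace_topol)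
  qed
qed

lemma carrier_Kor_heisenberg: "carrier (Kor (heisenberg A)) = carrier A \<times> {(0, 0)}"
proof (rule subset_antisym)
  let ?H = "heisenberg A"
  let ?D = "discrete_topology UNIV :: ('a gens \<times> 'a gens) topology"
  interpret H: topological_group ?H by (rule topological_group_heisenberg)
  have char: "continuous_map (topol ?H) euclidean (\<lambda>h. g (snd h))" for g :: "_ \<Rightarrow> complex"
    using continuous_map_compose[of "topol ?H" ?D snd euclidean g]
    by (simp add: heis_simps continuous_map_snd o_def)
  show "carrier (Kor ?H) \<subseteq> carrier A \<times> {(0, 0)}"
  proof
    fix h assume h: "h \<in> carrier (Kor ?H)"
    then obtain a x y where hH: "h = (a, x, y)" "a \<in> carrier A"
      using topological_group_subset_Kor[OF topological_group_heisenberg] by (auto simp: heis_simps)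
    \<comment> \<open>Each integer coordinate of the abelian quotient yields a character, and the
      cocycle does not enter the quotient.\<close>
    have "(2::complex) powi (Poly_Mapping.lookup (fst (snd h)) k) = 1" for k
      by (rule Kor_character[OF H.topspace_topol _ _ char h, of "\<lambda>p. 2 powi (Poly_Mapping.lookup (fst p) k)"])
        (auto simp: heis_simps lookup_add power_int_add)
    moreover have "(2::complex) powi (Poly_Mapping.lookup (snd (snd h)) k) = 1" for k
      by (rule Kor_character[OF H.topspace_topol _ _ char h, of "\<lambda>p. 2 powi (Poly_Mapping.lookup (snd p) k)"])
        (auto simp: heis_simps lookup_add power_int_add)
    ultimately have "x = 0" "y = 0"
      using two_powi_eq_1 by (auto simp: hH intro!: poly_mapping_eqI)
    then show "h \<in> carrier A \<times> {(0, 0)}" using hH by simp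
  qed
  show "carrier A \<times> {(0, 0)} \<subseteq> carrier (Kor ?H)"
  proof clarify
    fix s assume s: "s \<in> carrier A"
    have "\<rho> (s, 0, 0) = 1\<^sub>m n" if rep: "ordinary_rep ?H n \<rho>" for n \<rho>
    proof -
      interpret \<rho>: group_hom ?H "GL n" \<rho>
        by (rule group_hom_ordinary_rep[OF rep group_heisenberg])
      \<comment> \<open>The element \<open>s\<close> stays fixed while \<open>i\<close> varies:
        \<open>?x i\<close> and \<open>?y j\<close> commute for distinct indices, and for equal ones
        their commutator is \<open>(s, 0, 0)\<close>.\<close>
      let ?e = "\<lambda>i. Poly_Mapping.single (i, s) (1::int)"
      let ?x = "\<lambda>i. (\<one>, ?e i, 0)" and ?y = "\<lambda>i. (\<one>, 0, ?e i)"
      have in_H: "(a, p) \<in> carrier ?H" if "a \<in> carrier A" for a p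
        using that by (simp add: heis_simps)
      have xy: "\<rho> (?x i) * \<rho> (?y j) = \<rho> (if i = j then s else \<one>, ?e i, ?e j)" for i j
        using s by (subst ordinary_rep_mult[OF rep, symmetric])
          (auto simp: in_H heis_simps(2) heis_pair_single)
      have yx: "\<rho> (?y j) * \<rho> (?x i) = \<rho> (\<one>, ?e i, ?e j)" for i j
        using s by (subst ordinary_rep_mult[OF rep, symmetric])
          (auto simp: in_H heis_simps(2))
      obtain k where "\<rho> (?x k) * \<rho> (?y k) = \<rho> (?y k) * \<rho> (?x k)"
        using exists_commuting_pair[of "\<lambda>i. \<rho> (?x i)" n "\<lambda>i. \<rho> (?y i)"]
          ordinary_rep_carrier_mat[OF rep in_H] by (auto simp: xy yx)
      \<comment> \<open>The two orders of multiplication differ by the central factor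
        \<open>s\<close> alone, so commuting images force \<open>s\<close> into the kernel.\<close>
      then have "\<rho> (s, ?e k, ?e k) = \<rho> (\<one>, ?e k, ?e k)" by (simp add: xy yx)
      moreover have "(s, ?e k, ?e k) = (s, 0, 0) \<otimes>\<^bsub>?H\<^esub> (\<one>, ?e k, ?e k)"
        using s by (simp add: heis_simps)
      ultimately have "\<rho> (s, 0, 0) \<otimes>\<^bsub>GL n\<^esub> \<rho> (\<one>, ?e k, ?e k) = \<rho> (\<one>, ?e k, ?e k)"
        using s in_H by (metis \<rho>.hom_mult one_closed)
      then have "\<rho> (s, 0, 0) = \<one>\<^bsub>GL n\<^esub>"
        using in_H s \<rho>.hom_closed by (metis \<rho>.H.r_cancel_one one_closed)
      then show ?thesis by (simp add: GL_simps)
    qed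
    then show "(s, 0, 0) \<in> carrier (Kor ?H)"
      using s by (simp add: carrier_Kor[OF H.topspace_topol] heis_simps)
  qed
qed

lemma Kor_heisenberg: "Kor (heisenberg A) \<cong>\<^sub>t A"
proof -
  let ?H = "heisenberg A"
  interpret H: topological_group ?H by (rule topological_group_heisenberg)
  note K = carrier_Kor_heisenberg
  have ts: "topspace (topol (Kor ?H)) = carrier (Kor ?H)"
    by (rule topological_groupD[OF topological_group_Kor[OF topological_group_heisenberg]])
  show ?thesis
  proof (rule topgroup_isoI[of fst _ _ "\<lambda>a. (a, 0, 0)"])
    show "fst \<in> hom (Kor ?H) A"
      by (auto simp: hom_def K heis_simps)
    show "continuous_map (topol (Kor ?H)) (topol A) fst"
      by (simp add: heis_simps continuous_map_from_subtopology continuous_map_fst)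
    show "continuous_map (topol A) (topol (Kor ?H)) (\<lambda>a. (a, 0, 0))"
      by (auto simp: continuous_map_in_subtopology K heis_simps topspace_topol
          intro!: continuous_map_pairedI)
  qed (auto simp: K topspace_topol H.topspace_topol heis_simps(1))
qed

end

text \<open>Infinitely many basis vectors for every element, and finite integer combinations of
  them, do not exceed the size of the infinite type \<open>'u\<close>, so the Heisenberg group has a
  copy there.\<close>

lemma abelian_in_Kor_class_LCG:
  fixes A :: "'u topgroup" and K :: "'k topgroup"
  assumes u: "infinite (UNIV :: 'u set)"
    and A: "topological_group A" "comm_group A" "locally_compact_space (topol A)"
    and K: "topological_group K" "A \<cong>\<^sub>t K"
  shows "K \<in> Kor_class (LCG :: 'u topgroup set)"
proof -
  interpret abelian_topgroup A
    using A by (simp add: abelian_topgroup_def)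
  have "(UNIV :: nat set) \<times> (UNIV :: 'u set) \<lesssim> (UNIV :: 'u set)"
    by (rule times_lepoll_infinite[OF u countable_lepoll_infinite[OF u] lepoll_refl])
  then have P: "(UNIV :: 'u gens set) \<lesssim> (UNIV :: 'u set)"
    by (intro poly_mapping_lepoll_infinite[OF u]) simp
  have "carrier (heisenberg A) \<lesssim> (UNIV :: 'u set)"
    using times_lepoll_infinite[OF u subset_imp_lepoll times_lepoll_infinite[OF u P P], of "carrier A"]
    by (simp add: heis_simps)
  moreover have "locally_compact_space (topol (heisenberg A))"
    by (simp add: heis_simps locally_compact_space_prod_topology A locally_compact_space_discrete_topology)
  ultimately show ?thesis
    using Kor_class_LCG_I[OF topological_group_heisenberg _ _ K(1) topgroup_iso_trans[OF Kor_heisenberg K(2)]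
        topological_group_Kor[OF topological_group_heisenberg]] by blast
qed

section \<open>Locally compact groups that equal their own Kor\<close>

lemma Kor_full_in_Kor_class_LCG:
  fixes G :: "'u topgroup"
  assumes G: "topological_group G" "locally_compact_space (topol G)"
    and full: "carrier (Kor G) = carrier G"
  shows "G \<in> Kor_class (LCG :: 'u topgroup set)"
proof -
  have ts: "topspace (topol G) = carrier G" by (rule topological_groupD[OF G(1)])
  have "G \<cong>\<^sub>t Kor G"
    by (rule topgroup_isoI[of id _ _ id])
      (use ts continuous_map_id[of "topol G"] subtopology_topspace[of "topol G"] in \<open>auto simp: hom_def full\<close>)
  then show ?thesis using G by (auto simp: Kor_class_def LCG_def)
qed

text \<open>Kernels are normal, so in a simple group a single nontrivial element makes a kernel the
  whole group.\<close>

lemma simple_Kor_full: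
  assumes G: "topological_group G" and simple: "is_simple G"
    and ker: "\<And>n \<rho>. ordinary_rep G n \<rho> \<Longrightarrow> \<exists>x\<in>carrier G. x \<noteq> \<one>\<^bsub>G\<^esub> \<and> \<rho> x = 1\<^sub>m n"
  shows "carrier (Kor G) = carrier G"
proof -
  interpret G: topological_group G by (rule G)
  have "\<rho> x = 1\<^sub>m n" if rep: "ordinary_rep G n \<rho>" and x: "x \<in> carrier G" for n \<rho> x
  proof -
    interpret \<rho>: group_hom G "GL n" \<rho>
      by (rule group_hom_ordinary_rep[OF rep G.group_axioms])
    have "kernel G (GL n) \<rho> = {\<one>\<^bsub>G\<^esub>} \<or> kernel G (GL n) \<rho> = carrier G"
      using simple \<rho>.normal_kernel by (auto simp: is_simple_def)
    then show ?thesis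
      using ker[OF rep] x by (auto simp: kernel_def GL_simps)
  qed
  then show ?thesis by (auto simp: carrier_Kor[OF G.topspace_topol])
qed

text \<open>In a locally compact Hausdorff space a compact component is a quasi-component. Hence a
  clopen set \<open>T\<close> separates \<open>x\<close> from the compact set \<open>C - W\<close>,
  and \<open>T \<inter> C = T \<inter> W\<close> is compact by the left-hand form and open by the
  right-hand one.\<close>

lemma totally_disconnected_compact_open_nhd:
  assumes X: "locally_compact_space X" "Hausdorff_space X" "totally_disconnected_space X"
    and U: "openin X U" "x \<in> U"
  obtains K where "openin X K" "compactin X K" "x \<in> K" "K \<subseteq> U"
proof -
  have "neighbourhood_base_of (compactin X) X"
    using X locally_compact_space_neighbourhood_base by blast
  then obtain W C where WC: "openin X W" "compactin X C" "x \<in> W" "W \<subseteq> C" "C \<subseteq> U"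
    using U unfolding neighbourhood_base_of by meson
  have xX: "x \<in> topspace X" using U openin_subset by blast
  have "connected_component_of_set X x = {x}"
    using X(3) xX by (auto simp: totally_disconnected_space_def)
  then have "{x} \<in> connected_components_of X"
    using xX by (auto simp: connected_components_of_def)
  then have q: "{x} \<in> quasi_components_of X"
    using compact_quasi_eq_connected_components_of[OF X(1,2), of "{x}"] xX by auto
  have "closedin X (topspace X - W)" using WC(1) by blast
  then have "compactin X ((topspace X - W) \<inter> C)" by (rule closed_Int_compactin[OF _ WC(2)])
  moreover have "(topspace X - W) \<inter> C = C - W" using compactin_subset_topspace[OF WC(2)] by blast
  ultimately have F: "compactin X (C - W)" by simp
  have "separated_between X {x} (C - W)"
    using separated_between_quasi_component_compact[OF q F] WC by (auto simp: disjnt_def)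
  then obtain T T' where T: "openin X T" "openin X T'" "T \<union> T' = topspace X" "disjnt T T'"
    "x \<in> T" "C - W \<subseteq> T'"
    by (auto simp: separated_between_def)
  have "T = topspace X - T'" using T(3,4) by (auto simp: disjnt_def)
  then have "closedin X T" using T(2) by blast
  then have "compactin X (T \<inter> C)" by (rule closed_Int_compactin[OF _ WC(2)])
  moreover have "T \<inter> C = T \<inter> W"
    using T(4,6) WC(4) by (auto simp: disjnt_def)
  ultimately show thesis
    using that[of "T \<inter> W"] T(1,5) WC by (auto intro: openin_Int)
qed

text \<open>The stabilizer of a compact open neighbourhood \<open>K\<close> of the identity under
  left multiplication is a subgroup. It lies in \<open>K\<close> because it moves the identity
  within \<open>K\<close>, and compactness of \<open>K\<close> makes it a neighbourhood of the
  identity.\<close>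

lemma van_Dantzig:
  assumes G: "topological_group G" "locally_compact_space (topol G)" "totally_disconnected_space (topol G)"
    and U: "openin (topol G) U" "\<one>\<^bsub>G\<^esub> \<in> U"
  obtains L V where "subgroup L G" "L \<subseteq> U" "openin (topol G) V" "\<one>\<^bsub>G\<^esub> \<in> V" "V \<subseteq> L"
proof -
  interpret G: topological_group G by (rule G)
  obtain K where K: "openin (topol G) K" "compactin (topol G) K" "\<one>\<^bsub>G\<^esub> \<in> K" "K \<subseteq> U"
    using totally_disconnected_compact_open_nhd[OF G(2) G.Hausdorff_topol G(3) U] .
  have KG: "K \<subseteq> carrier G" using K(1) openin_subset G.topspace_topol by blast
  define L where "L = {g \<in> carrier G. (\<forall>k\<in>K. g \<otimes>\<^bsub>G\<^esub> k \<in> K) \<and> (\<forall>k\<in>K. inv\<^bsub>G\<^esub> g \<otimes>\<^bsub>G\<^esub> k \<in> K)}"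
  have "subgroup L G"
  proof (rule G.subgroupI)
    show "L \<noteq> {}" using KG by (auto simp: L_def subset_eq intro!: exI[of _ "\<one>\<^bsub>G\<^esub>"])
  qed (use KG in \<open>auto simp: L_def G.m_assoc G.inv_mult_group subset_eq\<close>)
  moreover have "L \<subseteq> U"
  proof
    fix g assume g: "g \<in> L"
    then have "g \<otimes>\<^bsub>G\<^esub> \<one>\<^bsub>G\<^esub> \<in> K" using K(3) by (auto simp: L_def simp del: G.r_one)
    then show "g \<in> U" using g K(4) by (auto simp: L_def)
  qed
  moreover have "\<exists>V. openin (topol G) V \<and> \<one>\<^bsub>G\<^esub> \<in> V \<and> V \<subseteq> L"
  proof -
    define W where "W = {z \<in> topspace (prod_topology (topol G) (topol G)). (\<lambda>(x, y). x \<otimes>\<^bsub>G\<^esub> y) z \<in> K}"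
    have "openin (prod_topology (topol G) (topol G)) W"
      unfolding W_def by (rule openin_continuous_map_preimage[OF G.continuous_mult K(1)])
    moreover have "{\<one>\<^bsub>G\<^esub>} \<times> K \<subseteq> W"
      using KG by (auto simp: W_def G.topspace_topol subset_eq)
    \<comment> \<open>The tube lemma turns openness of \<open>W\<close> along the compact slice over
      the identity into one neighbourhood \<open>N\<close> that works for all of \<open>K\<close>;
      intersecting with its inverse controls both conditions in \<open>L\<close>.\<close>
    ultimately obtain N O' where N: "openin (topol G) N" "\<one>\<^bsub>G\<^esub> \<in> N" "K \<subseteq> O'" "N \<times> O' \<subseteq> W"
      using tube_lemma_right[of "topol G" "topol G" W K "\<one>\<^bsub>G\<^esub>"] K(2) G.topspace_topol by auto
    define N' where "N' = {x \<in> topspace (topol G). inv\<^bsub>G\<^esub> x \<in> N}"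
    have "openin (topol G) N'"
      unfolding N'_def by (rule openin_continuous_map_preimage[OF G.continuous_inv N(1)])
    moreover have "N \<inter> N' \<subseteq> L"
      using N by (auto simp: N'_def L_def W_def G.topspace_topol subset_eq)
    ultimately show ?thesis
      using N by (intro exI[of _ "N \<inter> N'"]) (auto simp: N'_def G.topspace_topol)
  qed
  ultimately show thesis using that by blast
qed

lemma discrete_if_one_open:
  assumes G: "topological_group G" and one: "openin (topol G) {\<one>\<^bsub>G\<^esub>}"
  shows "discrete_topgroup G"
proof -
  interpret G: topological_group G by (rule G)
  have "openin (topol G) {g}" if g: "g \<in> carrier G" for g
  proof -
    have "continuous_map (topol G) (topol G) (\<lambda>x. inv\<^bsub>G\<^esub> g \<otimes>\<^bsub>G\<^esub> x)"
      using g by (intro continuous_map_topgroup_mult[OF G]) (auto simp: G.topspace_topol)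
    then have "openin (topol G) {x \<in> topspace (topol G). inv\<^bsub>G\<^esub> g \<otimes>\<^bsub>G\<^esub> x \<in> {\<one>\<^bsub>G\<^esub>}}"
      by (rule openin_continuous_map_preimage[OF _ one])
    moreover have "{x \<in> topspace (topol G). inv\<^bsub>G\<^esub> g \<otimes>\<^bsub>G\<^esub> x \<in> {\<one>\<^bsub>G\<^esub>}} = {g}"
      using g by (auto simp: G.topspace_topol) (metis G.inv_closed G.inv_equality G.inv_inv)
    ultimately show ?thesis by simp
  qed
  then show ?thesis
    by (auto simp: discrete_topgroup_def discrete_topology_unique G.topspace_topol[symmetric]
        intro: sym)
qed

lemma simple_totally_disconnected_in_Kor_class_LCG:
  fixes G :: "'u topgroup"
  assumes G: "G \<in> LCG" "is_simple G" "\<not> discrete_topgroup G" "totally_disconnected_space (topol G)"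
  shows "G \<in> Kor_class (LCG :: 'u topgroup set)"
proof -
  have tg: "topological_group G" "locally_compact_space (topol G)" using G(1) by (auto simp: LCG_def)
  have "\<exists>x\<in>carrier G. x \<noteq> \<one>\<^bsub>G\<^esub> \<and> \<rho> x = 1\<^sub>m n" if rep: "ordinary_rep G n \<rho>" for n \<rho>
  proof -
    obtain U where U: "openin (topol G) U" "\<one>\<^bsub>G\<^esub> \<in> U"
      "\<And>L x. subgroup L G \<Longrightarrow> L \<subseteq> U \<Longrightarrow> x \<in> L \<Longrightarrow> \<rho> x = 1\<^sub>m n"
      using ordinary_rep_no_small_subgroups[OF tg(1) rep] by blast
    obtain L V where L: "subgroup L G" "L \<subseteq> U" "openin (topol G) V" "\<one>\<^bsub>G\<^esub> \<in> V" "V \<subseteq> L"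
      using van_Dantzig[OF tg G(4) U(1,2)] .
    \<comment> \<open>Translations would spread openness of the trivial subgroup to all points, so
      in a non-discrete group \<open>V\<close> contains a nontrivial element.\<close>
    have "V \<noteq> {\<one>\<^bsub>G\<^esub>}" using discrete_if_one_open[OF tg(1)] L(3) G(3) by auto
    then obtain x where "x \<in> V" "x \<noteq> \<one>\<^bsub>G\<^esub>" using L(4) by blast
    then show ?thesis using U(3)[OF L(1,2), of x] L(5) subgroup.mem_carrier[OF L(1)] by blast
  qed
  then show ?thesis
    using Kor_full_in_Kor_class_LCG[OF tg] simple_Kor_full[OF tg(1) G(2)] by blast
qed

section \<open>Discrete simple groups without injective representations\<close>

lemma discrete_topgroup_locally_compact:
  "discrete_topgroup G \<Longrightarrow> locally_compact_space (topol G)"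
  by (simp add: discrete_topgroup_def locally_compact_space_discrete_topology)

lemma noninjective_reps_in_Kor_class_LCG:
  fixes G :: "'u topgroup"
  assumes G: "topological_group G" "is_simple G" "discrete_topgroup G"
    and ninj: "\<And>n \<rho>. ordinary_rep G n \<rho> \<Longrightarrow> \<not> inj_on \<rho> (carrier G)"
  shows "G \<in> Kor_class (LCG :: 'u topgroup set)"
proof -
  have "\<exists>x\<in>carrier G. x \<noteq> \<one>\<^bsub>G\<^esub> \<and> \<rho> x = 1\<^sub>m n" if rep: "ordinary_rep G n \<rho>" for n \<rho>
  proof -
    interpret \<rho>: group_hom G "GL n" \<rho>
      by (rule group_hom_ordinary_rep[OF rep topological_groupD(1)[OF G(1)]])
    have "kernel G (GL n) \<rho> \<noteq> {\<one>\<^bsub>G\<^esub>}" using ninj[OF rep] \<rho>.inj_iff_trivial_ker by blast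
    moreover have "\<one>\<^bsub>G\<^esub> \<in> kernel G (GL n) \<rho>" by (simp add: kernel_def)
    ultimately show ?thesis by (auto simp: kernel_def GL_simps)
  qed
  then show ?thesis
    using Kor_full_in_Kor_class_LCG[OF G(1) discrete_topgroup_locally_compact[OF G(3)]]
      simple_Kor_full[OF G(1,2)] by blast
qed

text \<open>A matrix is encoded by the rational cuts of the real and imaginary parts of its entries,
  hence by a subset of a countable set; the boolean in \<open>cut\<close> tells the two parts
  apart.\<close>

lemma carrier_mat_lepoll_continuum: "(carrier_mat n n :: complex mat set) \<lesssim> (UNIV :: nat set set)"
proof -
  define cut :: "complex mat \<Rightarrow> (nat \<times> nat \<times> bool \<times> rat) set" where
    "cut A = {(i, j, b, q). i < n \<and> j < n \<and> of_rat q < (if b then Re else Im) (A $$ (i, j))}" for A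
  have reals: "x = y" if "\<And>q. real_of_rat q < x \<longleftrightarrow> real_of_rat q < y" for x y :: real
  proof (rule linorder_cases[of x y])
    assume "x < y"
    then obtain q where "x < real_of_rat q" "real_of_rat q < y" using of_rat_dense by blast
    with that[of q] show ?thesis by simp
  next
    assume "y < x"
    then obtain q where "y < real_of_rat q" "real_of_rat q < x" using of_rat_dense by blast
    with that[of q] show ?thesis by simp
  qed
  have "inj_on cut (carrier_mat n n)"
  proof (rule inj_onI)
    fix A B :: "complex mat"
    assume A: "A \<in> carrier_mat n n" and B: "B \<in> carrier_mat n n" and eq: "cut A = cut B"
    have *: "(if b then Re else Im) (A $$ (i, j)) = (if b then Re else Im) (B $$ (i, j))"
      if "i < n" "j < n" for i j b
    proof (rule reals)
      fix q
      have "(i, j, b, q) \<in> cut A \<longleftrightarrow> (i, j, b, q) \<in> cut B" by (simp add: eq)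
      then show "of_rat q < (if b then Re else Im) (A $$ (i, j)) \<longleftrightarrow>
          of_rat q < (if b then Re else Im) (B $$ (i, j))"
        using that by (simp add: cut_def)
    qed
    show "A = B"
      using *[where b = True] *[where b = False] A B by (intro eq_matI complex_eqI) auto
  qed
  then have "inj_on (image to_nat \<circ> cut) (carrier_mat n n)"
    by (rule comp_inj_on) (auto simp: inj_on_def inj_image_eq_iff)
  then show ?thesis by (auto simp: lepoll_def)
qed

lemma large_simple_in_Kor_class_LCG:
  fixes G :: "'u topgroup"
  assumes G: "topological_group G" "is_simple G" "discrete_topgroup G"
    and large: "(UNIV :: nat set set) \<prec> carrier G"
  shows "G \<in> Kor_class (LCG :: 'u topgroup set)"
proof (rule noninjective_reps_in_Kor_class_LCG[OF G])
  fix n \<rho> assume rep: "ordinary_rep G n \<rho>"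
  show "\<not> inj_on \<rho> (carrier G)"
  proof
    assume "inj_on \<rho> (carrier G)"
    then have "carrier G \<lesssim> (carrier_mat n n :: complex mat set)"
      using ordinary_rep_carrier_mat[OF rep] by (auto simp: lepoll_def)
    also have "\<dots> \<lesssim> (UNIV :: nat set set)" by (rule carrier_mat_lepoll_continuum)
    finally show False using large lesspoll_trans2 by blast
  qed
qed

section \<open>Monothetic groups and Lie groups\<close>

lemma closure_of_commuting:
  assumes G: "topological_group G" and S: "S \<subseteq> carrier G" and h: "h \<in> carrier G"
    and comm: "\<And>x. x \<in> S \<Longrightarrow> x \<otimes>\<^bsub>G\<^esub> h = h \<otimes>\<^bsub>G\<^esub> x"
    and x: "x \<in> topol G closure_of S"
  shows "x \<otimes>\<^bsub>G\<^esub> h = h \<otimes>\<^bsub>G\<^esub> x"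
proof -
  interpret G: topological_group G by (rule G)
  have "closedin (topol G) {x \<in> topspace (topol G). x \<otimes>\<^bsub>G\<^esub> h = h \<otimes>\<^bsub>G\<^esub> x}"
    using h by (intro closedin_continuous_maps_eq[OF G.Hausdorff_topol]
        continuous_map_topgroup_mult[OF G]) (auto simp: G.topspace_topol)
  from closure_of_minimal[OF _ this, of S] show ?thesis
    using comm S x by (auto simp: G.topspace_topol)
qed

text \<open>Centralizers are closed in a Hausdorff group, so density is used twice: once to pass
  from powers of \<open>g\<close> to arbitrary elements in the first argument, once more in that
  argument when the second is arbitrary too.\<close>

lemma monothetic_imp_comm_group:
  assumes G: "topological_group G" and mono: "monothetic G"
  shows "comm_group G"
proof -
  interpret G: topological_group G by (rule G)
  obtain g where g: "g \<in> carrier G" and dense: "topol G closure_of (generate G {g}) = carrier G"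
    using mono by (auto simp: monothetic_def)
  have gen: "generate G {g} = {g [^]\<^bsub>G\<^esub> k | k. k \<in> (UNIV :: int set)}"
    by (rule G.generate_pow[OF g])
  have pow_comm: "g [^]\<^bsub>G\<^esub> (k::int) \<otimes>\<^bsub>G\<^esub> h = h \<otimes>\<^bsub>G\<^esub> g [^]\<^bsub>G\<^esub> k"
    if h: "h \<in> generate G {g}" for h k
  proof -
    obtain l :: int where l: "h = g [^]\<^bsub>G\<^esub> l" using h gen by auto
    show ?thesis unfolding l using G.int_pow_mult[OF g, of k l] G.int_pow_mult[OF g, of l k]
      by (simp add: add.commute)
  qed
  have gc: "generate G {g} \<subseteq> carrier G" using g G.generate_incl by simp
  have 1: "x \<otimes>\<^bsub>G\<^esub> h = h \<otimes>\<^bsub>G\<^esub> x" if "x \<in> carrier G" "h \<in> generate G {g}" for x h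
  proof (rule closure_of_commuting[OF G gc])
    show "y \<otimes>\<^bsub>G\<^esub> h = h \<otimes>\<^bsub>G\<^esub> y" if y: "y \<in> generate G {g}" for y
      using pow_comm[OF \<open>h \<in> generate G {g}\<close>] y gen by auto
  qed (use that gc dense in auto)
  have "x \<otimes>\<^bsub>G\<^esub> y = y \<otimes>\<^bsub>G\<^esub> x" if "x \<in> carrier G" "y \<in> carrier G" for x y
    by (rule closure_of_commuting[OF G gc]) (use that 1 dense in auto)
  then show ?thesis by (intro G.group_comm_groupI)
qed

text \<open>A chart identifies an open neighbourhood with an open subset of Euclidean space. Since
  the chart domain is open, a compact neighbourhood inside it is also one in the group.\<close>

lemma lie_group_locally_compact:
  assumes "lie_group G"
  shows "topological_group G" "locally_compact_space (topol G)"
proof -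
  let ?X = "topol G"
  show "topological_group G" using assms by (simp add: lie_group_def)
  obtain n \<A> where A: "smooth_atlas n ?X \<A>" using assms by (auto simp: lie_group_def)
  show "locally_compact_space ?X"
    unfolding locally_compact_space_def
  proof
    fix x assume "x \<in> topspace ?X"
    then have "x \<in> \<Union>(fst ` \<A>)" using A by (simp add: smooth_atlas_def)
    then obtain c where c: "c \<in> \<A>" "x \<in> fst c" by blast
    then have "is_chart n ?X c" using A by (simp add: smooth_atlas_def)
    then obtain U \<xi> where x: "x \<in> U" and chart: "is_chart n ?X (U, \<xi>)"
      using c by (cases c) auto
    then have U: "openin ?X U" and im: "openin (Euclidean_space n) (\<xi> ` U)"
      and homeo: "homeomorphic_map (subtopology ?X U) (subtopology (Euclidean_space n) (\<xi> ` U)) \<xi>"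
      by (auto simp: is_chart_def)
    have "locally_compact_space (subtopology (Euclidean_space n) (\<xi> ` U))"
      using locally_compact_space_open_subset[OF _ locally_compact_Euclidean_space im]
        Hausdorff_Euclidean_space by blast
    then have "locally_compact_space (subtopology ?X U)"
      using homeomorphic_locally_compact_space[OF homeomorphic_map_imp_homeomorphic_space[OF homeo]] by simp
    moreover have "x \<in> topspace (subtopology ?X U)" using x U openin_subset by fastforce
    ultimately obtain V K where "openin (subtopology ?X U) V" "compactin (subtopology ?X U) K" "x \<in> V" "V \<subseteq> K"
      unfolding locally_compact_space_def by blast
    then show "\<exists>V K. openin ?X V \<and> compactin ?X K \<and> x \<in> V \<and> V \<subseteq> K"
      using openin_open_subtopology[OF U] by (auto simp: compactin_subtopology)
  qed
qed

section \<open>Products\<close>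

lemma product_topgroup_simps:
  "carrier (product_topgroup I G) = (\<Pi>\<^sub>E i\<in>I. carrier (G i))"
  "x \<otimes>\<^bsub>product_topgroup I G\<^esub> y = (\<lambda>i\<in>I. x i \<otimes>\<^bsub>G i\<^esub> y i)"
  "\<one>\<^bsub>product_topgroup I G\<^esub> = (\<lambda>i\<in>I. \<one>\<^bsub>G i\<^esub>)"
  "topol (product_topgroup I G) = product_topology (\<lambda>i. topol (G i)) I"
  by (simp_all add: product_topgroup_def)

lemma continuous_map_product_component:
  "continuous_map X (product_topology Y I) f \<Longrightarrow> i \<in> I \<Longrightarrow> continuous_map X (Y i) (\<lambda>x. f x i)"
  by (auto simp: continuous_map_componentwise)

lemma topological_group_product:
  assumes G: "\<And>i. i \<in> I \<Longrightarrow> topological_group (G i)"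
  shows "topological_group (product_topgroup I G)"
proof -
  let ?P = "product_topgroup I G"
  have gr: "group (G i)" if "i \<in> I" for i using topological_groupD(1)[OF G[OF that]] .
  have ts: "topspace (topol (G i)) = carrier (G i)" if "i \<in> I" for i
    using topological_groupD(2)[OF G[OF that]] .
  have tsP: "topspace (topol ?P) = carrier ?P"
    by (simp add: product_topgroup_simps) (rule PiE_cong, simp add: ts)
  have "group (product_group I G)" by (rule product_group) (rule gr)
  then interpret group ?P
    unfolding group_def group_axioms_def monoid_def Units_def
    by (simp add: product_topgroup_def)
  have inv: "inv\<^bsub>?P\<^esub> x = (\<lambda>i\<in>I. inv\<^bsub>G i\<^esub> x i)" if "x \<in> carrier ?P" for x
    by (rule inv_equality) (use that gr in \<open>auto simp: product_topgroup_simps PiE_iff group.l_inv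
        intro!: restrict_ext\<close>)
  show ?thesis
  proof
    show "topspace (topol ?P) = carrier ?P" by (rule tsP)
    show "Hausdorff_space (topol ?P)"
      using G by (auto simp: product_topgroup_simps Hausdorff_space_product_topology
          topological_group_def topological_group_axioms_def)
    let ?PP = "prod_topology (topol ?P) (topol ?P)"
    have 1: "continuous_map ?PP (topol (G i)) (\<lambda>z. fst z i)" if "i \<in> I" for i
      using continuous_map_product_component[of ?PP "\<lambda>i. topol (G i)" I fst] that
      by (simp add: product_topgroup_simps continuous_map_fst)
    have 2: "continuous_map ?PP (topol (G i)) (\<lambda>z. snd z i)" if "i \<in> I" for i
      using continuous_map_product_component[of ?PP "\<lambda>i. topol (G i)" I snd] that
      by (simp add: product_topgroup_simps continuous_map_snd)
    have "continuous_map ?PP (topol ?P) (\<lambda>z. fst z \<otimes>\<^bsub>?P\<^esub> snd z)"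
      unfolding product_topgroup_simps(2) product_topgroup_simps(4)[of I G]
      by (subst continuous_map_componentwise)
        (auto intro!: continuous_map_topgroup_mult[OF G] 1[unfolded product_topgroup_simps(4)]
          2[unfolded product_topgroup_simps(4)])
    then show "continuous_map ?PP (topol ?P) (\<lambda>(x, y). x \<otimes>\<^bsub>?P\<^esub> y)"
      by (simp add: case_prod_unfold)
    have "continuous_map (topol ?P) (topol ?P) (\<lambda>x. \<lambda>i\<in>I. inv\<^bsub>G i\<^esub> x i)"
      unfolding product_topgroup_simps(4)[of I G]
      by (subst continuous_map_componentwise)
        (auto intro!: continuous_map_topgroup_inv[OF G] continuous_map_product_projection)
    then show "continuous_map (topol ?P) (topol ?P) (\<lambda>x. inv\<^bsub>?P\<^esub> x)"
      by (rule continuous_map_eq) (simp add: inv tsP)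
  qed
qed

lemma topgroup_iso_product:
  assumes G: "\<And>i. i \<in> I \<Longrightarrow> topological_group (G i)" and H: "\<And>i. i \<in> I \<Longrightarrow> topological_group (H i)"
    and iso: "\<And>i. i \<in> I \<Longrightarrow> G i \<cong>\<^sub>t H i"
  shows "product_topgroup I G \<cong>\<^sub>t product_topgroup I H"
proof -
  \<comment> \<open>Each isomorphism is packaged with its inverse, so that one application of choice
    selects both.\<close>
  define Q where "Q i \<phi> \<psi> \<longleftrightarrow> \<phi> \<in> hom (G i) (H i) \<and> \<psi> \<in> hom (H i) (G i) \<and>
    (\<forall>x\<in>carrier (G i). \<psi> (\<phi> x) = x) \<and> (\<forall>y\<in>carrier (H i). \<phi> (\<psi> y) = y) \<and>
    continuous_map (topol (G i)) (topol (H i)) \<phi> \<and> continuous_map (topol (H i)) (topol (G i)) \<psi>"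
    for i \<phi> \<psi>
  have "\<forall>i\<in>I. \<exists>p. Q i (fst p) (snd p)"
  proof
    fix i assume i: "i \<in> I"
    show "\<exists>p. Q i (fst p) (snd p)"
    proof (rule topgroup_isoE[OF iso[OF i] topological_groupD(1,2)[OF G[OF i]] topological_groupD(2)[OF H[OF i]]])
      fix \<phi> \<psi>
      assume a: "\<phi> \<in> hom (G i) (H i)" "\<psi> \<in> hom (H i) (G i)"
        "\<And>x. x \<in> carrier (G i) \<Longrightarrow> \<psi> (\<phi> x) = x" "\<And>y. y \<in> carrier (H i) \<Longrightarrow> \<phi> (\<psi> y) = y"
        "continuous_map (topol (G i)) (topol (H i)) \<phi>" "continuous_map (topol (H i)) (topol (G i)) \<psi>"
      have "Q i \<phi> \<psi>" unfolding Q_def by (intro conjI ballI a)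
      then show ?thesis by (intro exI[of _ "(\<phi>, \<psi>)"]) simp
    qed
  qed
  from bchoice[OF this] obtain p where p: "\<forall>i\<in>I. Q i (fst (p i)) (snd (p i))" ..
  define \<phi> where "\<phi> i = fst (p i)" for i
  define \<psi> where "\<psi> i = snd (p i)" for i
  have *: "\<phi> i \<in> hom (G i) (H i)" "\<psi> i \<in> hom (H i) (G i)"
    "\<And>x. x \<in> carrier (G i) \<Longrightarrow> \<psi> i (\<phi> i x) = x"
    "\<And>y. y \<in> carrier (H i) \<Longrightarrow> \<phi> i (\<psi> i y) = y"
    "continuous_map (topol (G i)) (topol (H i)) (\<phi> i)"
    "continuous_map (topol (H i)) (topol (G i)) (\<psi> i)" if "i \<in> I" for i
    using p that by (auto simp: Q_def \<phi>_def \<psi>_def)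
  have cl: "\<phi> i x \<in> carrier (H i)" if "i \<in> I" "x \<in> carrier (G i)" for i x
    using *(1)[OF that(1)] that(2) by (auto simp: hom_def)
  have cl': "\<psi> i x \<in> carrier (G i)" if "i \<in> I" "x \<in> carrier (H i)" for i x
    using *(2)[OF that(1)] that(2) by (auto simp: hom_def)
  have cont: "continuous_map (product_topology X I) (product_topology Y I) (\<lambda>x. \<lambda>i\<in>I. f i (x i))"
    if f: "\<And>i. i \<in> I \<Longrightarrow> continuous_map (X i) (Y i) (f i)" for X :: "'a \<Rightarrow> 'z topology" and Y :: "'a \<Rightarrow> 'w topology" and f
  proof (subst continuous_map_componentwise, intro conjI ballI)
    fix i assume i: "i \<in> I"
    show "continuous_map (product_topology X I) (Y i) (\<lambda>x. (\<lambda>i\<in>I. f i (x i)) i)"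
      using continuous_map_compose[OF continuous_map_product_projection[OF i, of X] f[OF i]] i
      by (simp add: o_def)
  qed auto
  note tsG = topological_groupD(2)[OF topological_group_product[OF G]]
  note tsH = topological_groupD(2)[OF topological_group_product[OF H]]
  show ?thesis
  proof (rule topgroup_isoI[of "\<lambda>x. \<lambda>i\<in>I. \<phi> i (x i)" _ _ "\<lambda>x. \<lambda>i\<in>I. \<psi> i (x i)"])
    show "(\<lambda>x. \<lambda>i\<in>I. \<phi> i (x i)) \<in> hom (product_topgroup I G) (product_topgroup I H)"
      using cl *(1) by (auto simp: hom_def product_topgroup_simps PiE_iff intro!: restrict_ext)
    show "(\<lambda>x. \<lambda>i\<in>I. \<psi> i (x i)) \<in> carrier (product_topgroup I H) \<rightarrow> carrier (product_topgroup I G)"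
      using cl' by (auto simp: product_topgroup_simps PiE_iff)
    show "(\<lambda>i\<in>I. \<psi> i ((\<lambda>i\<in>I. \<phi> i (x i)) i)) = x" if "x \<in> carrier (product_topgroup I G)" for x
      using that *(3) by (intro extensionalityI[of _ I]) (auto simp: product_topgroup_simps PiE_iff)
    show "(\<lambda>i\<in>I. \<phi> i ((\<lambda>i\<in>I. \<psi> i (x i)) i)) = x" if "x \<in> carrier (product_topgroup I H)" for x
      using that *(4) by (intro extensionalityI[of _ I]) (auto simp: product_topgroup_simps PiE_iff)
    show "continuous_map (topol (product_topgroup I G)) (topol (product_topgroup I H)) (\<lambda>x. \<lambda>i\<in>I. \<phi> i (x i))"
      unfolding product_topgroup_simps(4) by (rule cont) (rule *(5))
    show "continuous_map (topol (product_topgroup I H)) (topol (product_topgroup I G)) (\<lambda>x. \<lambda>i\<in>I. \<psi> i (x i))"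
      unfolding product_topgroup_simps(4) by (rule cont) (rule *(6))
  qed (rule tsG tsH, assumption)+
qed

text \<open>Projections send Kor into the Kor of the factors. Conversely, a representation
  restricted to an embedded factor kills its Kor, and an element of a finite product is a finite
  product of elements from embedded factors.\<close>

lemma carrier_Kor_product:
  assumes I: "finite I" and G: "\<And>i. i \<in> I \<Longrightarrow> topological_group (G i)"
  shows "carrier (Kor (product_topgroup I G)) = (\<Pi>\<^sub>E i\<in>I. carrier (Kor (G i)))"
proof (rule subset_antisym)
  let ?P = "product_topgroup I G"
  have tP: "topological_group ?P" by (rule topological_group_product[OF G])
  have gr: "group (G i)" and ts: "topspace (topol (G i)) = carrier (G i)" if "i \<in> I" for i
    using topological_groupD[OF G[OF that]] by auto
  note tsP = topological_groupD(2)[OF tP]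
  show "carrier (Kor ?P) \<subseteq> (\<Pi>\<^sub>E i\<in>I. carrier (Kor (G i)))"
  proof
    fix x assume x: "x \<in> carrier (Kor ?P)"
    then have xP: "x \<in> carrier ?P" using topological_group_subset_Kor[OF tP] by blast
    have "x i \<in> carrier (Kor (G i))" if i: "i \<in> I" for i
      by (rule Kor_mono_hom[of ?P "G i" "\<lambda>x. x i", OF tsP ts[OF i] _ _ x])
        (use i continuous_map_product_projection[OF i, of "\<lambda>i. topol (G i)"] in
          \<open>auto simp: hom_def product_topgroup_simps\<close>)
    then show "x \<in> (\<Pi>\<^sub>E i\<in>I. carrier (Kor (G i)))"
      using xP by (auto simp: product_topgroup_simps PiE_iff)
  qed
  show "(\<Pi>\<^sub>E i\<in>I. carrier (Kor (G i))) \<subseteq> carrier (Kor ?P)"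
  proof
    fix x assume x: "x \<in> (\<Pi>\<^sub>E i\<in>I. carrier (Kor (G i)))"
    have xG: "x i \<in> carrier (G i)" if "i \<in> I" for i
      using x that topological_group_subset_Kor[OF G[OF that]] by (auto simp: PiE_iff)
    have "\<rho> x = 1\<^sub>m n" if rep: "ordinary_rep ?P n \<rho>" for n \<rho>
    proof -
      \<comment> \<open>The induction runs over the set \<open>F\<close> of coordinates that have
        not been replaced by the identity.\<close>
      have "\<rho> (\<lambda>j\<in>I. if j \<in> F then x j else \<one>\<^bsub>G j\<^esub>) = 1\<^sub>m n" if "F \<subseteq> I" for F
        using finite_subset[OF that I] that
      proof (induction F rule: finite_induct)
        case empty
        show ?case
          using ordinary_rep_one[OF rep topological_groupD(1)[OF tP]]
          by (simp add: product_topgroup_simps restrict_def)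
      next
        case (insert i F)
        let ?e = "\<lambda>g. \<lambda>j\<in>I. if j = i then g else \<one>\<^bsub>G j\<^esub>"
        have i: "i \<in> I" using insert by simp
        have "?e \<in> hom (G i) ?P"
          using gr i by (auto simp: hom_def product_topgroup_simps group.is_monoid intro!: restrict_ext)
        moreover have "continuous_map (topol (G i)) (topol ?P) ?e"
          unfolding product_topgroup_simps
        proof (subst continuous_map_componentwise, intro conjI ballI)
          fix j assume j: "j \<in> I"
          show "continuous_map (topol (G i)) (topol (G j)) (\<lambda>g. ?e g j)"
            using j gr[OF j] ts[OF j] by (cases "j = i") (auto simp: group.is_monoid)
        qed auto
        ultimately have "ordinary_rep (G i) n (\<rho> \<circ> ?e)" by (rule ordinary_rep_comp[OF rep])
        then have e1: "\<rho> (?e (x i)) = 1\<^sub>m n"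
          using x i by (auto simp: PiE_iff carrier_Kor[OF ts[OF i]])
        let ?y = "\<lambda>j\<in>I. if j \<in> F then x j else \<one>\<^bsub>G j\<^esub>"
        have "(\<lambda>j\<in>I. if j \<in> insert i F then x j else \<one>\<^bsub>G j\<^esub>) = ?e (x i) \<otimes>\<^bsub>?P\<^esub> ?y"
          using insert xG gr
          by (auto simp: product_topgroup_simps group.is_monoid intro!: restrict_ext)
        moreover have "?e (x i) \<in> carrier ?P" "?y \<in> carrier ?P"
          using xG gr by (auto simp: product_topgroup_simps group.is_monoid)
        moreover have "\<rho> ?y = 1\<^sub>m n" using insert.IH insert.prems by blast
        ultimately show ?case
          using e1 by (simp only: ordinary_rep_mult[OF rep]) simp
      qed
      from this[of I] have "\<rho> (restrict x I) = 1\<^sub>m n" by (simp cong: restrict_cong)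
      then show ?thesis using x by (simp add: PiE_iff extensional_restrict)
    qed
    then show "x \<in> carrier (Kor ?P)"
      using x xG by (auto simp: carrier_Kor[OF tsP] product_topgroup_simps PiE_iff)
  qed
qed

lemma Kor_product:
  assumes "finite I" "\<And>i. i \<in> I \<Longrightarrow> topological_group (G i)"
  shows "Kor (product_topgroup I G) = product_topgroup I (\<lambda>i. Kor (G i))"
  using carrier_Kor_product[OF assms]
  by (simp add: Kor_eq_restrict[of "product_topgroup I G"] restrict_topgroup_def
      product_topgroup_def product_group_def subtopology_product_topology)

lemma PiE_lepoll_infinite:
  fixes A :: "'i \<Rightarrow> 'a set"
  assumes u: "infinite (UNIV :: 'u set)" and I: "finite I"
    and A: "\<And>i. i \<in> I \<Longrightarrow> A i \<lesssim> (UNIV :: 'u set)"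
  shows "Pi\<^sub>E I A \<lesssim> (UNIV :: 'u set)"
  using I A
proof (induction I rule: finite_induct)
  case empty
  show ?case by (auto simp: lepoll_def)
next
  case (insert i I)
  have "inj_on (\<lambda>f. (f i, restrict f I)) (Pi\<^sub>E (insert i I) A)"
  proof (rule inj_onI, rule ext)
    fix f g j assume "f \<in> Pi\<^sub>E (insert i I) A" "g \<in> Pi\<^sub>E (insert i I) A"
      and "(f i, restrict f I) = (g i, restrict g I)"
    then show "f j = g j"
      by (cases "j \<in> insert i I") (auto simp: PiE_iff extensional_def dest: fun_cong[of _ _ j])
  qed
  then have "Pi\<^sub>E (insert i I) A \<lesssim> A i \<times> Pi\<^sub>E I A"
    by (auto simp: lepoll_def PiE_iff intro!: exI[of _ "\<lambda>f. (f i, restrict f I)"])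
  also have "\<dots> \<lesssim> (UNIV :: 'u set)"
    using insert by (intro times_lepoll_infinite[OF u]) auto
  finally show ?case .
qed

lemma finite_product_in_Kor_class_LCG:
  fixes G :: "'i \<Rightarrow> 'k topgroup"
  assumes u: "infinite (UNIV :: 'u set)" and I: "finite I"
    and G: "\<And>i. i \<in> I \<Longrightarrow> G i \<in> Kor_class (LCG :: 'u topgroup set)"
  shows "product_topgroup I G \<in> Kor_class (LCG :: 'u topgroup set)"
proof -
  have "\<forall>i\<in>I. \<exists>H :: 'u topgroup. topological_group H \<and> locally_compact_space (topol H) \<and> G i \<cong>\<^sub>t Kor H"
    using G by (auto simp: Kor_class_def LCG_def)
  then obtain H :: "'i \<Rightarrow> 'u topgroup" where H: "\<And>i. i \<in> I \<Longrightarrow> topological_group (H i)"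
    "\<And>i. i \<in> I \<Longrightarrow> locally_compact_space (topol (H i))" "\<And>i. i \<in> I \<Longrightarrow> G i \<cong>\<^sub>t Kor (H i)"
    by metis
  have tG: "\<And>i. i \<in> I \<Longrightarrow> topological_group (G i)" using G by (auto simp: Kor_class_def)
  have tK: "\<And>i. i \<in> I \<Longrightarrow> topological_group (Kor (H i))" using H topological_group_Kor by blast
  show ?thesis
  proof (rule Kor_class_LCG_I[of "product_topgroup I H"])
    show "locally_compact_space (topol (product_topgroup I H))"
      using I H by (simp add: product_topgroup_simps locally_compact_space_product_topology)
    show "carrier (product_topgroup I H) \<lesssim> (UNIV :: 'u set)"
      unfolding product_topgroup_simps
      by (rule PiE_lepoll_infinite[OF u I]) (simp add: subset_imp_lepoll)
    show "Kor (product_topgroup I H) \<cong>\<^sub>t product_topgroup I G"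
      by (subst Kor_product[OF I H(1)], assumption)
        (rule topgroup_iso_product[OF tK tG topgroup_iso_sym[OF H(3) tG tK]])
  qed (use topological_group_product topological_group_Kor H tG in blast)+
qed

text \<open>The infinite cyclic group, placed inside the type \<open>real\<close> so that it fits
  the type at which closure under infinite products is refuted.\<close>

definition discrete_int :: "real topgroup"
  where "discrete_int = \<lparr>carrier = \<int>, mult = (+), one = 0, topol = discrete_topology \<int>\<rparr>"

lemma discrete_int_in_Kor_class_LCG:
  assumes u: "infinite (UNIV :: 'u set)"
  shows "discrete_int \<in> Kor_class (LCG :: 'u topgroup set)"
proof -
  have "comm_group discrete_int"
    by (rule comm_groupI) (auto simp: discrete_int_def intro: exI[of _ "- _"] bexI[of _ "- _"])
  then interpret Z: comm_group discrete_int .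
  have Z: "topological_group discrete_int"
    by unfold_locales
      (auto simp: discrete_int_def Hausdorff_space_discrete_topology
        prod_topology_discrete_topology[symmetric] 
        intro: Z.inv_closed[unfolded discrete_int_def, simplified])
  obtain f :: "int \<Rightarrow> 'u" where f: "inj f"
    using countable_lepoll_infinite[OF u, where ?'c = int] by (auto simp: lepoll_def)
  \<comment> \<open>\<open>floor\<close> recovers the integer from its image in the reals.\<close>
  have "inj_on (f \<circ> floor) (carrier discrete_int)"
    using f by (auto simp: discrete_int_def inj_on_def Ints_def)
  from topgroup_transport[OF Z this]
  obtain A :: "'u topgroup" where A: "topological_group A" "discrete_int \<cong>\<^sub>t A" .
  obtain \<phi> where "\<phi> \<in> iso discrete_int A" using A(2) by (auto simp: topgroup_iso_def)
  then have "comm_group (A\<lparr>one := \<phi> \<one>\<^bsub>discrete_int\<^esub>\<rparr>)" "\<phi> \<in> hom discrete_int A"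
    using Z.iso_imp_img_comm_group by (auto simp: iso_def)
  then have cA: "comm_group A"
    using hom_one[of \<phi> discrete_int A] A(1) Z.group_axioms topological_groupD(1) by fastforce
  have "locally_compact_space (topol A)"
    using topgroup_iso_locally_compact[OF A(2)]
    by (simp add: discrete_int_def locally_compact_space_discrete_topology)
  then show ?thesis
    using abelian_in_Kor_class_LCG[OF u A(1) cA _ Z topgroup_iso_sym[OF A(2) Z A(1)]] by blast
qed

text \<open>A compact neighbourhood in an infinite product would project onto all but finitely many
  factors, whereas here no factor is compact.\<close>

lemma infinite_product_not_in_Kor_class_LCG:
  "product_topgroup (UNIV :: nat set) (\<lambda>_. discrete_int) \<notin> Kor_class (LCG :: 'u topgroup set)"
proof
  let ?P = "product_topgroup (UNIV :: nat set) (\<lambda>_. discrete_int)"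
  assume "?P \<in> Kor_class (LCG :: 'u topgroup set)"
  then obtain H :: "'u topgroup" where "topological_group H" "locally_compact_space (topol H)" "?P \<cong>\<^sub>t Kor H"
    by (auto simp: Kor_class_def LCG_def)
  then have "locally_compact_space (topol ?P)"
    using topgroup_iso_locally_compact locally_compact_Kor by blast
  moreover have "\<not> compact_space (topol discrete_int)"
    using finite_imageD[of "of_int :: int \<Rightarrow> real" UNIV]
    by (auto simp: discrete_int_def compact_space_discrete_topology Ints_def inj_def)
  moreover have "topspace (product_topology (\<lambda>_::nat. topol discrete_int) UNIV) \<noteq> {}"
    by (auto simp: discrete_int_def PiE_eq_empty_iff)
  ultimately show False
    by (auto simp: product_topgroup_simps locally_compact_space_product_topology)
qed

section \<open>Commuting families of matrices of finite exponent\<close>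

text \<open>Vectors are infinite sequences, so that subspaces of every \<open>coord_space n\<close>
  share one type.\<close>

definition is_subspace :: "(nat \<Rightarrow> complex) set \<Rightarrow> bool"
  where "is_subspace V \<longleftrightarrow> (\<lambda>_. 0) \<in> V \<and> (\<forall>u\<in>V. \<forall>v\<in>V. \<forall>c. (\<lambda>i. u i + c * v i) \<in> V)"

definition is_linear :: "((nat \<Rightarrow> complex) \<Rightarrow> (nat \<Rightarrow> complex)) \<Rightarrow> bool"
  where "is_linear T \<longleftrightarrow> (\<forall>u v c. T (\<lambda>i. u i + c * v i) = (\<lambda>i. T u i + c * T v i))"

definition coord_space :: "nat \<Rightarrow> (nat \<Rightarrow> complex) set"
  where "coord_space n = {v. \<forall>i\<ge>n. v i = 0}"

lemma is_linear_zero: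
  assumes "is_linear T"
  shows "T (\<lambda>_. 0) = (\<lambda>_. 0)"
  \<comment> \<open>The coefficient -1 with both vectors zero reads
    \<open>T 0 = T 0 - T 0\<close>.\<close>
  using assms[unfolded is_linear_def, rule_format, of "\<lambda>_. 0" "-1" "\<lambda>_. 0"] by simp

lemma is_subspace_sum:
  assumes V: "is_subspace V" and "finite J" "\<And>j. j \<in> J \<Longrightarrow> w j \<in> V"
  shows "(\<lambda>i. \<Sum>j\<in>J. c j * w j i) \<in> V"
  using assms(2,3)
proof (induction J rule: finite_induct)
  case empty
  then show ?case using V by (simp add: is_subspace_def)
next
  case (insert j J)
  then have "(\<lambda>i. (\<Sum>j\<in>J. c j * w j i) + c j * w j i) \<in> V"
    using V by (simp add: is_subspace_def)
  then show ?case using insert by (simp add: add.commute)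
qed

lemma is_linear_sum:
  assumes T: "is_linear T" and "finite J"
  shows "T (\<lambda>i. \<Sum>j\<in>J. c j * w j i) = (\<lambda>i. \<Sum>j\<in>J. c j * T (w j) i)"
  using assms(2)
proof (induction J rule: finite_induct)
  case empty
  then show ?case using is_linear_zero[OF T] by simp
next
  case (insert j J)
  have "T (\<lambda>i. (\<Sum>j\<in>J. c j * w j i) + c j * w j i) =
      (\<lambda>i. T (\<lambda>i. \<Sum>j\<in>J. c j * w j i) i + c j * T (w j) i)"
    using T by (simp add: is_linear_def)
  then show ?case using insert by (simp add: add.commute)
qed

text \<open>Takes the place of induction on dimension. In a strictly descending chain, pick
  \<open>v i\<close> in the \<open>i\<close>-th space but not in the next. Among the first
  \<open>n + 1\<close> of these there is a linear relation, and its lowest nonzero term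
  \<open>v m\<close> is a combination of later vectors, all of which lie in the space after the
  \<open>m\<close>-th.\<close>

lemma wf_subspaces: "wf {(W, V). is_subspace W \<and> W \<subset> V \<and> V \<subseteq> coord_space n}"
  unfolding wf_iff_no_infinite_down_chain
proof
  assume "\<exists>f. \<forall>i. (f (Suc i), f i) \<in> {(W, V). is_subspace W \<and> W \<subset> V \<and> V \<subseteq> coord_space n}"
  then obtain f where *: "\<And>i. (f (Suc i), f i) \<in> {(W, V). is_subspace W \<and> W \<subset> V \<and> V \<subseteq> coord_space n}"
    by blast
  have f: "is_subspace (f (Suc i))" "f (Suc i) \<subset> f i" "f i \<subseteq> coord_space n" for i
    using *[of i] by auto
  have "\<forall>i. \<exists>v. v \<in> f i \<and> v \<notin> f (Suc i)" using f(2) by blast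
  then obtain v where v: "\<And>i. v i \<in> f i" "\<And>i. v i \<notin> f (Suc i)" by metis
  obtain c where c: "\<exists>j\<in>{..n}. c j \<noteq> 0" "\<And>i. i < n \<Longrightarrow> (\<Sum>j\<le>n. c j * v j i) = 0"
    using exists_linear_dependence[of "{..<n}" "{..n}" v] by auto
  have "v j i = 0" if "i \<ge> n" for i j
    using v(1)[of j] f(3)[of j] that by (auto simp: coord_space_def)
  then have c0: "(\<Sum>j\<le>n. c j * v j i) = 0" for i
    using c(2) by (cases "i < n") auto
  define m where "m = (LEAST j. j \<le> n \<and> c j \<noteq> 0)"
  have m: "m \<le> n" "c m \<noteq> 0"
    using c(1) LeastI_ex[of "\<lambda>j. j \<le> n \<and> c j \<noteq> 0"] by (auto simp: m_def)
  have below: "c j = 0" if "j < m" for j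
    using not_less_Least[of j "\<lambda>j. j \<le> n \<and> c j \<noteq> 0"] that m(1) by (auto simp: m_def)
  have anti: "f j \<subseteq> f i" if "i \<le> j" for i j
    using that f(2) by (induction rule: dec_induct) blast+
  have "v m i = (\<Sum>j\<in>{m<..n}. (- c j / c m) * v j i)" for i
  proof -
    have "(\<Sum>j\<le>n. c j * v j i) = (\<Sum>j\<in>insert m {m<..n}. c j * v j i)"
      by (rule sum.mono_neutral_right) (use m below in \<open>auto simp: not_less\<close>)
    also have "\<dots> = c m * v m i + (\<Sum>j\<in>{m<..n}. c j * v j i)"
      by simp
    finally have "c m * v m i = - (\<Sum>j\<in>{m<..n}. c j * v j i)"
      using c0[of i] by (simp add: eq_neg_iff_add_eq_0)
    then have "v m i = - (\<Sum>j\<in>{m<..n}. c j * v j i) / c m"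
      using m by (simp add: field_simps)
    then show ?thesis by (simp add: sum_divide_distrib sum_negf)
  qed
  then have "v m = (\<lambda>i. \<Sum>j\<in>{m<..n}. (- c j / c m) * v j i)" by blast
  also have "\<dots> \<in> f (Suc m)"
    by (rule is_subspace_sum[OF f(1)]) (use v(1) anti in \<open>auto simp: subset_eq Suc_le_eq\<close>)
  finally show False using v(2) by blast
qed

text \<open>On \<open>E\<close> the map \<open>g\<close> factors through \<open>F\<close>, so its
  image is no larger than that of \<open>F\<close>.\<close>

lemma finite_image_factor:
  assumes "finite (F ` E)" "\<And>x y. x \<in> E \<Longrightarrow> y \<in> E \<Longrightarrow> F x = F y \<Longrightarrow> g x = g y"
  shows "finite (g ` E)"
proof (rule finite_subset)
  show "g ` E \<subseteq> (\<lambda>z. g (SOME x. x \<in> E \<and> F x = z)) ` F ` E"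
  proof
    fix w assume "w \<in> g ` E"
    then obtain x where x: "x \<in> E" "w = g x" by blast
    have "(SOME y. y \<in> E \<and> F y = F x) \<in> E \<and> F (SOME y. y \<in> E \<and> F y = F x) = F x"
      by (rule someI[of _ x]) (use x in auto)
    then have "g (SOME y. y \<in> E \<and> F y = F x) = g x" using assms(2) x by blast
    then show "w \<in> (\<lambda>z. g (SOME x. x \<in> E \<and> F x = z)) ` F ` E" using x by force
  qed
qed (use assms(1) in blast)

lemma exists_primitive_root_of_unity:
  assumes "p > 0"
  obtains \<eta> :: complex where "\<eta> ^ p = 1" "\<forall>k. 0 < k \<and> k < p \<longrightarrow> \<eta> ^ k \<noteq> 1"
proof
  let ?\<eta> = "cis (2 * pi / real p)"
  have pow: "?\<eta> ^ k = cis (2 * pi * real k / real p)" for k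
    by (simp add: Complex.DeMoivre mult_ac)
  show "?\<eta> ^ p = 1" using assms by (simp add: pow)
  have "?\<eta> ^ k \<noteq> 1" if "0 < k" "k < p" for k
    using inj_onD[OF bij_betw_imp_inj_on[OF Complex.bij_betw_roots_unity[OF assms]], of k 0] that
    by (auto simp: pow)
  then show "\<forall>k. 0 < k \<and> k < p \<longrightarrow> ?\<eta> ^ k \<noteq> 1" by blast
qed

text \<open>The \<open>e j\<close> form the discrete Fourier transform of the periodic orbit of
  \<open>v\<close>: each is the component of \<open>v\<close> in the eigenspace for the
  \<open>j\<close>-th power of \<open>1 / \<eta>\<close>, and together they sum to \<open>v\<close>.
  The factor 1 in that sum matches the shape of \<open>is_linear_sum\<close>.\<close>

lemma eigenvector_decomposition:
  assumes p: "p > 0" and T: "is_linear T" and v: "(T ^^ p) v = v"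
    and \<eta>: "\<eta> ^ p = (1::complex)" "\<forall>k. 0 < k \<and> k < p \<longrightarrow> \<eta> ^ k \<noteq> 1"
    and e: "e = (\<lambda>j i. \<Sum>k<p. (\<eta> ^ (j * k) / of_nat p) * (T ^^ k) v i)"
  shows "T (e j) = (\<lambda>i. (1 / \<eta>) ^ j * e j i)" and "v = (\<lambda>i. \<Sum>j<p. 1 * e j i)"
proof -
  have \<eta>0: "\<eta> \<noteq> 0" using \<eta>(1) p by (auto simp: power_0_left)
  have "T (e j) = (\<lambda>i. \<Sum>k<p. (\<eta> ^ (j * k) / of_nat p) * (T ^^ Suc k) v i)"
    unfolding e by (subst is_linear_sum[OF T]) auto
  also have "\<dots> = (\<lambda>i. (1 / \<eta>) ^ j * e j i)"
  proof
    fix i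
    let ?h = "\<lambda>k. (\<eta> ^ (j * k) / of_nat p) * (T ^^ k) v i"
    have "(\<Sum>k<p. (\<eta> ^ (j * k) / of_nat p) * (T ^^ Suc k) v i) = (\<Sum>k<p. (1 / \<eta>) ^ j * ?h (Suc k))"
      using \<eta>0 by (intro sum.cong) (auto simp: power_add power_divide)
    also have "\<dots> = (1 / \<eta>) ^ j * (\<Sum>k<p. ?h (Suc k))" by (simp only: sum_distrib_left)
    also have "(\<Sum>k<p. ?h (Suc k)) = (\<Sum>k<p. ?h k)"
    proof -
      \<comment> \<open>Periodicity: applying \<open>T\<close> shifts the summation index
        cyclically, and the new last term equals the old first one.\<close>
      have "?h p = ?h 0" using v \<eta>(1) by (simp add: mult.commute[of j] power_mult)
      moreover have "(\<Sum>k<p. ?h k) + ?h p = ?h 0 + (\<Sum>k<p. ?h (Suc k))"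
        by (rule trans[OF sum.lessThan_Suc[symmetric] sum.lessThan_Suc_shift])
      ultimately show ?thesis by (metis (no_types, lifting) add.commute add_left_cancel)
    qed
    finally show "(\<Sum>k<p. (\<eta> ^ (j * k) / of_nat p) * (T ^^ Suc k) v i) = (1 / \<eta>) ^ j * e j i"
      by (simp add: e)
  qed
  finally show "T (e j) = (\<lambda>i. (1 / \<eta>) ^ j * e j i)" .
  \<comment> \<open>Orthogonality of the characters of a cyclic group, as a geometric sum;
    primitivity of \<open>\<eta>\<close> keeps its ratio away from 1.\<close>
  have geo: "(\<Sum>j<p. \<eta> ^ (j * k)) = 0" if k: "0 < k" "k < p" for k
  proof -
    have "(\<eta> ^ k) ^ p = 1" using \<eta>(1) by (metis mult.commute power_mult power_one)
    then have "(\<Sum>j<p. (\<eta> ^ k) ^ j) = 0" using \<eta>(2) k by (simp add: geometric_sum)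
    then show ?thesis by (simp add: power_mult[symmetric] mult.commute)
  qed
  have "(\<Sum>j<p. 1 * e j i) = v i" for i
  proof -
    have "(\<Sum>j<p. 1 * e j i) = (\<Sum>k<p. (\<Sum>j<p. \<eta> ^ (j * k)) / of_nat p * (T ^^ k) v i)"
      unfolding e mult_1 by (subst sum.swap) (simp add: sum_distrib_right sum_divide_distrib)
    also have "\<dots> = (\<Sum>k\<in>{0}. (\<Sum>j<p. \<eta> ^ (j * k)) / of_nat p * (T ^^ k) v i)"
      by (rule sum.mono_neutral_right) (use p geo in auto)
    finally show ?thesis using p by simp
  qed
  then show "v = (\<lambda>i. \<Sum>j<p. 1 * e j i)" by simp
qed

text \<open>If every operator acts on \<open>V\<close> by a power of \<open>1 / \<eta>\<close>,
  there are at most \<open>p\<close> restrictions. Otherwise some \<open>h\<close> does not, so its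
  eigenspaces in \<open>V\<close> are proper; they are invariant by commutativity and span
  \<open>V\<close>, whence finiteness on each of them gives finiteness on \<open>V\<close>.\<close>

lemma finite_commuting_finite_order:
  fixes T :: "'e \<Rightarrow> (nat \<Rightarrow> complex) \<Rightarrow> (nat \<Rightarrow> complex)"
  assumes p: "p > 0"
    and lin: "\<And>g. g \<in> E \<Longrightarrow> is_linear (T g)"
    and comm: "\<And>g h v. g \<in> E \<Longrightarrow> h \<in> E \<Longrightarrow> T g (T h v) = T h (T g v)"
    and order: "\<And>g v. g \<in> E \<Longrightarrow> v \<in> coord_space n \<Longrightarrow> (T g ^^ p) v = v"
    and V: "is_subspace V" "V \<subseteq> coord_space n" "\<And>g v. g \<in> E \<Longrightarrow> v \<in> V \<Longrightarrow> T g v \<in> V"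
  shows "finite ((\<lambda>g. restrict (T g) V) ` E)"
  using V
proof (induction V rule: wf_induct_rule[OF wf_subspaces[of n]])
  case (1 V)
  obtain \<eta> :: complex where \<eta>: "\<eta> ^ p = 1" "\<forall>k. 0 < k \<and> k < p \<longrightarrow> \<eta> ^ k \<noteq> 1"
    using exists_primitive_root_of_unity[OF p] .
  show ?case
  proof (cases "\<forall>g\<in>E. \<exists>j<p. \<forall>v\<in>V. T g v = (\<lambda>i. (1 / \<eta>) ^ j * v i)")
    case True
    have "(\<lambda>g. restrict (T g) V) ` E \<subseteq> (\<lambda>j. \<lambda>v\<in>V. \<lambda>i. (1 / \<eta>) ^ j * v i) ` {..<p}"
    proof clarify
      fix g assume "g \<in> E"
      then obtain j where j: "j < p" "\<And>v. v \<in> V \<Longrightarrow> T g v = (\<lambda>i. (1 / \<eta>) ^ j * v i)" using True by blast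
      then show "restrict (T g) V \<in> (\<lambda>j. \<lambda>v\<in>V. \<lambda>i. (1 / \<eta>) ^ j * v i) ` {..<p}"
        by (intro image_eqI[of _ _ j]) auto
    qed
    then show ?thesis by (rule finite_subset) simp
  next
    case False
    then obtain h where h: "h \<in> E" "\<And>j. j < p \<Longrightarrow> \<exists>v\<in>V. T h v \<noteq> (\<lambda>i. (1 / \<eta>) ^ j * v i)" by blast
    define W where "W j = {v \<in> V. T h v = (\<lambda>i. (1 / \<eta>) ^ j * v i)}" for j
    have W: "is_subspace (W j)" for j
      using 1(2) lin[OF h(1)] is_linear_zero[OF lin[OF h(1)]]
      by (auto simp: W_def is_subspace_def is_linear_def algebra_simps)
    have fin: "finite ((\<lambda>g. restrict (T g) (W j)) ` E)" if j: "j < p" for j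
    proof (rule 1(1))
      show "(W j, V) \<in> {(W, V). is_subspace W \<and> W \<subset> V \<and> V \<subseteq> coord_space n}"
        using W h(2)[OF j] 1(3) by (auto simp: W_def)
      show "W j \<subseteq> coord_space n" using 1(3) by (auto simp: W_def)
      fix g v assume g: "g \<in> E" and v: "v \<in> W j"
      have "T h (T g v) = T g (\<lambda>i. (1 / \<eta>) ^ j * v i)"
        using comm[OF h(1) g] v by (simp add: W_def)
      also have "\<dots> = (\<lambda>i. (1 / \<eta>) ^ j * T g v i)"
        using is_linear_sum[OF lin[OF g], of "{()}" "\<lambda>_. (1 / \<eta>) ^ j" "\<lambda>_. v"] by simp
      finally show "T g v \<in> W j" using 1(4)[OF g] v by (simp add: W_def)
    qed (rule W)
    \<comment> \<open>The tuple of restrictions to all eigenspaces of \<open>h\<close> takes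
      finitely many values and determines the action on \<open>V\<close>.\<close>
    let ?F = "\<lambda>g. \<lambda>j\<in>{..<p}. restrict (T g) (W j)"
    have "?F ` E \<subseteq> (\<Pi>\<^sub>E j\<in>{..<p}. (\<lambda>g. restrict (T g) (W j)) ` E)" by auto
    then have "finite (?F ` E)"
      by (rule finite_subset) (intro finite_PiE, use fin in auto)
    then show ?thesis
    proof (rule finite_image_factor)
      fix f g assume fg: "f \<in> E" "g \<in> E" and eq: "?F f = ?F g"
      have agree: "T f v = T g v" if "j < p" "v \<in> W j" for j v
        using fun_cong[OF fun_cong[OF eq, of j], of v] that by simp
      show "restrict (T f) V = restrict (T g) V"
      proof (rule restrict_ext)
        fix v assume v: "v \<in> V"
        define e where "e = (\<lambda>j i. \<Sum>k<p. (\<eta> ^ (j * k) / of_nat p) * (T h ^^ k) v i)"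
        have ord: "(T h ^^ p) v = v" using order[OF h(1)] v 1(3) by blast
        note dec = eigenvector_decomposition[OF p lin[OF h(1)] ord \<eta> e_def]
        have "(T h ^^ k) v \<in> V" for k
          by (induction k) (use v 1(4)[OF h(1)] in auto)
        then have "e j \<in> V" for j
          unfolding e_def by (intro is_subspace_sum[OF 1(2)]) auto
        then have "e j \<in> W j" for j using dec(1) by (simp add: W_def)
        then have *: "T f (e j) = T g (e j)" if "j < p" for j using agree that by blast
        have "T f v = (\<lambda>i. \<Sum>j<p. 1 * T f (e j) i)"
          by (subst dec(2)) (rule is_linear_sum[OF lin[OF fg(1)]], simp)
        also have "\<dots> = (\<lambda>i. \<Sum>j<p. 1 * T g (e j) i)" using * by simp
        also have "\<dots> = T g v"
          by (subst dec(2)) (rule is_linear_sum[OF lin[OF fg(2)], symmetric], simp)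
        finally show "T f v = T g v" .
      qed
    qed
  qed
qed

text \<open>Reading and writing only the first \<open>n\<close> coordinates makes linearity and
  compatibility with products hold on all sequences; the identity matrix, however, acts as the
  identity only on \<open>coord_space n\<close>.\<close>

definition mat_act :: "nat \<Rightarrow> complex mat \<Rightarrow> (nat \<Rightarrow> complex) \<Rightarrow> (nat \<Rightarrow> complex)"
  where "mat_act n A v = (\<lambda>i. if i < n then \<Sum>j<n. A $$ (i, j) * v j else 0)"

lemma is_linear_mat_act: "is_linear (mat_act n A)"
  by (auto simp: is_linear_def mat_act_def sum_distrib_left sum.distrib distrib_left mult_ac)

lemma mat_act_mult:
  assumes "A \<in> carrier_mat n n" "B \<in> carrier_mat n n"
  shows "mat_act n (A * B) v = mat_act n A (mat_act n B v)"
proof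
  fix i
  have "(\<Sum>j<n. (\<Sum>k<n. A $$ (i, k) * B $$ (k, j)) * v j) =
      (\<Sum>k<n. A $$ (i, k) * (\<Sum>j<n. B $$ (k, j) * v j))"
    unfolding sum_distrib_left sum_distrib_right by (subst sum.swap) (simp add: mult_ac)
  then show "mat_act n (A * B) v i = mat_act n A (mat_act n B v) i"
    using assms by (simp add: mat_act_def scalar_prod_def atLeast0LessThan)
qed

lemma mat_act_one: "v \<in> coord_space n \<Longrightarrow> mat_act n (1\<^sub>m n) v = v"
  by (rule ext) (auto simp: mat_act_def coord_space_def if_distrib[of "\<lambda>x. x * _"] cong: if_cong)

lemma mat_act_inject:
  assumes A: "A \<in> carrier_mat n n" and B: "B \<in> carrier_mat n n"
    and eq: "\<And>v. v \<in> coord_space n \<Longrightarrow> mat_act n A v = mat_act n B v"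
  shows "A = B"
proof (rule eq_matI)
  fix i j assume "i < dim_row B" "j < dim_col B"
  then have ij: "i < n" "j < n" using B by auto
  have "(\<lambda>k. if k = j then 1 else 0) \<in> coord_space n" using ij by (auto simp: coord_space_def)
  from fun_cong[OF eq[OF this], of i] show "A $$ (i, j) = B $$ (i, j)"
    using ij by (simp add: mat_act_def if_distrib[of "\<lambda>x. _ * x"] cong: if_cong)
qed (use A B in auto)

text \<open>An injective representation would embed the infinite set \<open>E\<close> into a finite
  set of commuting operators of order dividing \<open>p\<close>.\<close>

lemma infinite_elementary_abelian_noninjective:
  assumes G: "topological_group G" and rep: "ordinary_rep G n \<rho>"
    and E: "subgroup E G" "infinite E" "elementary_abelian (G\<lparr>carrier := E\<rparr>)"
  shows "\<not> inj_on \<rho> (carrier G)"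
proof
  assume inj: "inj_on \<rho> (carrier G)"
  interpret G: topological_group G by (rule G)
  interpret E: comm_group "G\<lparr>carrier := E\<rparr>" using E(3) by (simp add: elementary_abelian_def)
  have EG: "E \<subseteq> carrier G" using E(1) subgroup.subset by blast
  obtain p :: nat where "p > 0" and exp: "\<And>x. x \<in> E \<Longrightarrow> x [^]\<^bsub>G\<lparr>carrier := E\<rparr>\<^esub> p = \<one>\<^bsub>G\<^esub>"
    using E(3) by (auto simp: elementary_abelian_def has_exponent_def)
  have pow: "x [^]\<^bsub>G\<^esub> p = \<one>\<^bsub>G\<^esub>" if "x \<in> E" for x
    using exp[OF that] by (simp add: nat_pow_def)
  let ?T = "\<lambda>g. mat_act n (\<rho> g)"
  have car: "\<rho> g \<in> carrier_mat n n" if "g \<in> E" for g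
    using that EG ordinary_rep_carrier_mat[OF rep] by blast
  have mult: "?T (g \<otimes>\<^bsub>G\<^esub> h) v = ?T g (?T h v)" if "g \<in> carrier G" "h \<in> carrier G" for g h v
    using that mat_act_mult ordinary_rep_carrier_mat[OF rep] by (simp add: ordinary_rep_mult[OF rep])
  have "finite ((\<lambda>g. restrict (?T g) (coord_space n)) ` E)"
  proof (rule finite_commuting_finite_order[OF \<open>p > 0\<close>])
    show "?T g (?T h v) = ?T h (?T g v)" if "g \<in> E" "h \<in> E" for g h v
      using E.m_comm[of g h] that EG by (simp add: mult[symmetric] subset_eq)
    show "(?T g ^^ p) v = v" if g: "g \<in> E" and v: "v \<in> coord_space n" for g v
    proof -
      have gG: "g \<in> carrier G" using g EG by blast
      have one: "?T \<one>\<^bsub>G\<^esub> v = v"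
        using ordinary_rep_one[OF rep G.group_axioms] mat_act_one[OF v] by simp
      have "(?T g ^^ k) v = ?T (g [^]\<^bsub>G\<^esub> k) v" for k
      proof (induction k)
        case (Suc k)
        have "g [^]\<^bsub>G\<^esub> Suc k = g \<otimes>\<^bsub>G\<^esub> g [^]\<^bsub>G\<^esub> k" using G.nat_pow_Suc2[OF gG] .
        then show ?case using Suc mult[OF gG] gG by simp
      qed (simp add: one)
      then show ?thesis using pow[OF g] one by simp
    qed
    show "is_subspace (coord_space n)" by (simp add: is_subspace_def coord_space_def)
    show "?T g v \<in> coord_space n" for g v by (simp add: coord_space_def mat_act_def)
  qed (simp_all add: is_linear_mat_act)
  moreover have "inj_on (\<lambda>g. restrict (?T g) (coord_space n)) E"
  proof (rule inj_onI)
    fix g h assume gh: "g \<in> E" "h \<in> E"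
      and eq: "restrict (?T g) (coord_space n) = restrict (?T h) (coord_space n)"
    have "\<rho> g = \<rho> h"
    proof (rule mat_act_inject[OF car car])
      show "?T g v = ?T h v" if "v \<in> coord_space n" for v
        using fun_cong[OF eq, of v] that by simp
    qed (use gh in auto)
    then show "g = h" using inj gh EG by (auto dest: inj_onD)
  qed
  ultimately show False using E(2) finite_imageD by blast
qed

section \<open>Infinite powers\<close>

text \<open>An integer action on the index set is kept abstract. Its decisive property is
  \<open>displace\<close>: every finite set of coordinates can be moved off itself by a single group
  element.\<close>

locale shifted_power =
  fixes D :: "'d set" and C :: "'c topgroup" and \<tau> :: "int \<Rightarrow> 'd \<Rightarrow> 'd"
  assumes C: "topological_group C" and compact: "compact_space (topol C)"
    and \<tau>_closed: "d \<in> D \<Longrightarrow> \<tau> m d \<in> D"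
    and \<tau>_zero: "d \<in> D \<Longrightarrow> \<tau> 0 d = d"
    and \<tau>_add: "d \<in> D \<Longrightarrow> \<tau> (m + k) d = \<tau> m (\<tau> k d)"
    and displace: "finite F \<Longrightarrow> F \<subseteq> D \<Longrightarrow> \<exists>m. \<forall>d\<in>F. \<tau> m d \<notin> F"
begin

abbreviation P :: "('d \<Rightarrow> 'c) topgroup" where "P \<equiv> product_topgroup D (\<lambda>_. C)"

text \<open>The semidirect product of the power with the integers, which permute coordinates through
  \<open>\<tau>\<close>. As the integers are discrete, the compact power is an open
  subgroup.\<close>

definition shift_group :: "(('d \<Rightarrow> 'c) \<times> int) topgroup"
  where "shift_group =
    \<lparr>carrier = carrier P \<times> UNIV,
     mult = (\<lambda>(f, m) (g, k). (\<lambda>d\<in>D. f d \<otimes>\<^bsub>C\<^esub> g (\<tau> m d), m + k)),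
     one = (\<one>\<^bsub>P\<^esub>, 0),
     topol = prod_topology (topol P) (discrete_topology UNIV)\<rparr>"

lemma shift_simps:
  "carrier shift_group = (D \<rightarrow>\<^sub>E carrier C) \<times> UNIV"
  "(f, m) \<otimes>\<^bsub>shift_group\<^esub> (g, k) = (\<lambda>d\<in>D. f d \<otimes>\<^bsub>C\<^esub> g (\<tau> m d), m + k)"
  "\<one>\<^bsub>shift_group\<^esub> = (\<lambda>d\<in>D. \<one>\<^bsub>C\<^esub>, 0)"
  "topol shift_group = prod_topology (product_topology (\<lambda>_. topol C) D) (discrete_topology UNIV)"
  by (simp_all add: shift_group_def product_topgroup_simps)

sublocale C: topological_group C by (rule C)

lemma group_shift_group: "group shift_group"
proof (rule groupI)
  fix u assume "u \<in> carrier shift_group"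
  then obtain f m where u: "u = (f, m)" "f \<in> D \<rightarrow>\<^sub>E carrier C" by (auto simp: shift_simps)
  have \<tau>: "\<tau> (- m) (\<tau> m d) = d" "\<tau> m (\<tau> (- m) d) = d" if "d \<in> D" for d
    using \<tau>_add[OF that, of "- m" m] \<tau>_add[OF that, of m "- m"] \<tau>_zero[OF that] by auto
  show "\<exists>v\<in>carrier shift_group. v \<otimes>\<^bsub>shift_group\<^esub> u = \<one>\<^bsub>shift_group\<^esub>"
    by (rule bexI[of _ "(\<lambda>d\<in>D. inv\<^bsub>C\<^esub> f (\<tau> (- m) d), - m)"])
      (use u \<tau>_closed in \<open>auto simp: shift_simps PiE_iff intro!: restrict_ext\<close>)
next
  fix u v w assume "u \<in> carrier shift_group" "v \<in> carrier shift_group" "w \<in> carrier shift_group"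
  then obtain f m g k h l where uvw: "u = (f, m)" "v = (g, k)" "w = (h, l)"
    "f \<in> D \<rightarrow>\<^sub>E carrier C" "g \<in> D \<rightarrow>\<^sub>E carrier C" "h \<in> D \<rightarrow>\<^sub>E carrier C"
    by (auto simp: shift_simps)
  \<comment> \<open>Precomposition with \<open>\<tau>\<close> reverses the order of composition,
    which is harmless because addition of integers commutes.\<close>
  have "\<tau> (m + k) d = \<tau> k (\<tau> m d)" if "d \<in> D" for d
    using \<tau>_add[OF that, of k m] by (simp add: add.commute)
  then show "u \<otimes>\<^bsub>shift_group\<^esub> v \<otimes>\<^bsub>shift_group\<^esub> w = u \<otimes>\<^bsub>shift_group\<^esub> (v \<otimes>\<^bsub>shift_group\<^esub> w)"
    using uvw \<tau>_closed by (auto simp: shift_simps PiE_iff C.m_assoc intro!: restrict_ext)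
qed (use \<tau>_closed \<tau>_zero in \<open>auto simp: shift_simps PiE_iff intro!: extensionalityI[of _ D]\<close>)

lemma inv_shift_group:
  assumes "f \<in> D \<rightarrow>\<^sub>E carrier C"
  shows "inv\<^bsub>shift_group\<^esub> (f, m) = (\<lambda>d\<in>D. inv\<^bsub>C\<^esub> f (\<tau> (- m) d), - m)"
proof (rule group.inv_equality[OF group_shift_group])
  show "(\<lambda>d\<in>D. inv\<^bsub>C\<^esub> f (\<tau> (- m) d), - m) \<otimes>\<^bsub>shift_group\<^esub> (f, m) = \<one>\<^bsub>shift_group\<^esub>"
    using assms \<tau>_closed by (auto simp: shift_simps PiE_iff intro!: restrict_ext)
qed (use assms \<tau>_closed in \<open>auto simp: shift_simps PiE_iff\<close>)

text \<open>The fibres of \<open>p\<close> are open and cover the space, and on each of them the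
  parameter is constant, so continuity may be checked for fixed \<open>m\<close>.\<close>

lemma continuous_map_discrete_parameter:
  assumes p: "continuous_map X (discrete_topology UNIV) p"
    and h: "\<And>m. continuous_map X Y (h m)"
  shows "continuous_map X Y (\<lambda>z. h (p z) z)"
proof -
  have "openin X {z \<in> topspace X. h (p z) z \<in> U}" if U: "openin Y U" for U
  proof -
    have "openin X ({z \<in> topspace X. p z \<in> {m}} \<inter> {z \<in> topspace X. h m z \<in> U})" for m
      by (intro openin_Int openin_continuous_map_preimage[OF p] openin_continuous_map_preimage[OF h U])
        simp
    then have "openin X (\<Union>m. {z \<in> topspace X. p z \<in> {m}} \<inter> {z \<in> topspace X. h m z \<in> U})"
      by blast
    also have "(\<Union>m. {z \<in> topspace X. p z \<in> {m}} \<inter> {z \<in> topspace X. h m z \<in> U})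
        = {z \<in> topspace X. h (p z) z \<in> U}"
      by auto
    finally show ?thesis .
  qed
  then show ?thesis
    using h by (auto simp: continuous_map_def)
qed

text \<open>For a fixed shift the twisted operations only permute coordinates before applying the
  operations of \<open>C\<close>; the dependence on the shift is through a discrete
  parameter.\<close>

lemma topological_group_shift_group: "topological_group shift_group"
proof -
  let ?H = shift_group
  let ?X = "product_topology (\<lambda>_. topol C) D"
  interpret H: group ?H by (rule group_shift_group)
  have ts: "topspace (topol ?H) = carrier ?H"
    by (simp add: shift_simps C.topspace_topol)
  have coord: "continuous_map X (topol C) (\<lambda>z. fst (q z) d)"
    if "continuous_map X (topol ?H) q" "d \<in> D" for X :: "'z topology" and q d
    using continuous_map_compose[OF continuous_map_compose[OF that(1)[unfolded shift_simps] continuous_map_fst]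
        continuous_map_product_projection[OF that(2)]] by (simp add: o_def)
  have int: "continuous_map X (discrete_topology UNIV) (\<lambda>z. snd (q z))"
    if "continuous_map X (topol ?H) q" for X :: "'z topology" and q
    using continuous_map_compose[OF that[unfolded shift_simps] continuous_map_snd] by (simp add: o_def)
  have toH: "continuous_map X (topol ?H) (\<lambda>z. (\<lambda>d\<in>D. f d z, k z))"
    if "\<And>d. d \<in> D \<Longrightarrow> continuous_map X (topol C) (f d)" "continuous_map X (discrete_topology UNIV) k"
    for X :: "'z topology" and f k
    unfolding shift_simps
  proof (intro continuous_map_pairedI that(2))
    show "continuous_map X ?X (\<lambda>z. \<lambda>d\<in>D. f d z)"
    proof (subst continuous_map_componentwise, intro conjI ballI)
      show "continuous_map X (topol C) (\<lambda>z. (\<lambda>d\<in>D. f d z) d)" if "d \<in> D" for d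
        using \<open>\<And>d. d \<in> D \<Longrightarrow> continuous_map X (topol C) (f d)\<close>[OF that] that by simp
    qed auto
  qed
  have dpair: "continuous_map X (discrete_topology UNIV) (\<lambda>z. g (a z) (b z))"
    if a: "continuous_map X (discrete_topology UNIV) a" and b: "continuous_map X (discrete_topology UNIV) b"
    for X :: "'z topology" and a b :: "'z \<Rightarrow> int" and g :: "int \<Rightarrow> int \<Rightarrow> int"
    by (rule continuous_map_discrete_parameter[OF a],
        rule continuous_map_discrete_parameter[OF b]) simp
  show ?thesis
  proof
    show "topspace (topol ?H) = carrier ?H" by (rule ts)
    show "Hausdorff_space (topol ?H)"
      by (simp add: shift_simps Hausdorff_space_prod_topology Hausdorff_space_product_topology C.Hausdorff_topol)
    let ?HH = "prod_topology (topol ?H) (topol ?H)"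
    have "continuous_map ?HH (topol C) (\<lambda>z. fst (fst z) d \<otimes>\<^bsub>C\<^esub> fst (snd z) (\<tau> (snd (fst z)) d))"
      if d: "d \<in> D" for d
    proof (rule continuous_map_topgroup_mult[OF C coord[OF continuous_map_fst d]])
      show "continuous_map ?HH (topol C) (\<lambda>z. fst (snd z) (\<tau> (snd (fst z)) d))"
        by (rule continuous_map_discrete_parameter[OF int[OF continuous_map_fst],
              where h = "\<lambda>m z. fst (snd z) (\<tau> m d)"])
          (rule coord[OF continuous_map_snd \<tau>_closed[OF d]])
    qed
    moreover have "continuous_map ?HH (discrete_topology UNIV) (\<lambda>z. snd (fst z) + snd (snd z))"
      by (rule dpair[OF int[OF continuous_map_fst] int[OF continuous_map_snd]])
    ultimately have "continuous_map ?HH (topol ?H) (\<lambda>z. (\<lambda>d\<in>D. fst (fst z) d \<otimes>\<^bsub>C\<^esub> fst (snd z) (\<tau> (snd (fst z)) d),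
        snd (fst z) + snd (snd z)))"
      by (rule toH)
    then show "continuous_map ?HH (topol ?H) (\<lambda>(x, y). x \<otimes>\<^bsub>?H\<^esub> y)"
      by (simp add: case_prod_unfold shift_group_def)
    have id: "continuous_map (topol ?H) (topol ?H) (\<lambda>x. x)" by simp
    have "continuous_map (topol ?H) (topol C) (\<lambda>z. inv\<^bsub>C\<^esub> fst z (\<tau> (- snd z) d))" if d: "d \<in> D" for d
    proof (rule continuous_map_topgroup_inv[OF C])
      show "continuous_map (topol ?H) (topol C) (\<lambda>z. fst z (\<tau> (- snd z) d))"
        by (rule continuous_map_discrete_parameter[OF int[OF id], where h = "\<lambda>m z. fst z (\<tau> (- m) d)"])
          (rule coord[OF id \<tau>_closed[OF d]])
    qed
    moreover have "continuous_map (topol ?H) (discrete_topology UNIV) (\<lambda>z. - snd z)"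
      by (rule dpair[OF int[OF id] int[OF id], of "\<lambda>a b. - a"])
    ultimately have "continuous_map (topol ?H) (topol ?H) (\<lambda>z. (\<lambda>d\<in>D. inv\<^bsub>C\<^esub> fst z (\<tau> (- snd z) d), - snd z))"
      by (rule toH)
    then show "continuous_map (topol ?H) (topol ?H) (\<lambda>x. inv\<^bsub>?H\<^esub> x)"
      by (rule continuous_map_eq) (auto simp: ts inv_shift_group shift_simps(1) simp del: restrict_apply)
  qed
qed

text \<open>By the absence of small subgroups a representation is trivial on all elements of the power
  that are trivial on some finite set \<open>F\<close> of coordinates; conjugating by a shift that moves \<open>F\<close> off
  itself deals with the elements supported in \<open>F\<close>.\<close>

lemma ordinary_rep_shift_group_trivial:
  assumes rep: "ordinary_rep shift_group n \<rho>" and f: "f \<in> D \<rightarrow>\<^sub>E carrier C"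
  shows "\<rho> (f, 0) = 1\<^sub>m n"
proof -
  let ?H = shift_group
  let ?X = "product_topology (\<lambda>_. topol C) D"
  interpret H: topological_group ?H by (rule topological_group_shift_group)
  interpret \<rho>: group_hom ?H "GL n" \<rho> by (rule group_hom_ordinary_rep[OF rep H.group_axioms])
  obtain U where U: "openin (topol ?H) U" "\<one>\<^bsub>?H\<^esub> \<in> U"
    "\<And>L x. subgroup L ?H \<Longrightarrow> L \<subseteq> U \<Longrightarrow> x \<in> L \<Longrightarrow> \<rho> x = 1\<^sub>m n"
    using ordinary_rep_no_small_subgroups[OF topological_group_shift_group rep] by blast
  have "continuous_map ?X (topol ?H) (\<lambda>f. (f, 0))"
    unfolding shift_simps by (intro continuous_map_pairedI) auto
  from openin_continuous_map_preimage[OF this U(1)]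
  have "openin ?X {f \<in> topspace ?X. (f, 0) \<in> U}" .
  moreover have "\<one>\<^bsub>P\<^esub> \<in> {f \<in> topspace ?X. (f, 0) \<in> U}"
    using U(2) by (simp add: shift_simps product_topgroup_simps C.topspace_topol)
  \<comment> \<open>A basic neighbourhood in the product topology restricts finitely many
    coordinates only; these form \<open>F\<close>.\<close>
  ultimately obtain B where B: "finite {d \<in> D. B d \<noteq> topspace (topol C)}" "\<one>\<^bsub>P\<^esub> \<in> Pi\<^sub>E D B"
    "Pi\<^sub>E D B \<subseteq> {f \<in> topspace ?X. (f, 0) \<in> U}"
    unfolding openin_product_topology_alt by meson
  define F where "F = {d \<in> D. B d \<noteq> topspace (topol C)}"
  have F: "finite F" "F \<subseteq> D" using B(1) by (auto simp: F_def)
  define L where "L = {g \<in> D \<rightarrow>\<^sub>E carrier C. \<forall>d\<in>F. g d = \<one>\<^bsub>C\<^esub>} \<times> {0::int}"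
  have "subgroup L ?H"
  proof (rule H.subgroupI)
    show "L \<noteq> {}" using F by (auto simp: L_def intro!: exI[of _ "\<lambda>d\<in>D. \<one>\<^bsub>C\<^esub>"])
  qed (use F \<tau>_zero in \<open>auto simp: L_def shift_simps inv_shift_group PiE_iff subset_eq\<close>)
  moreover have "L \<subseteq> U"
  proof
    fix x assume "x \<in> L"
    then obtain g where g: "x = (g, 0)" "g \<in> D \<rightarrow>\<^sub>E carrier C" "\<forall>d\<in>F. g d = \<one>\<^bsub>C\<^esub>"
      by (auto simp: L_def)
    have "g d \<in> B d" if "d \<in> D" for d
      using that g B(2) by (cases "d \<in> F") (auto simp: F_def product_topgroup_simps C.topspace_topol PiE_iff)
    then have "g \<in> Pi\<^sub>E D B" using g(2) by (auto simp: PiE_iff)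
    then show "x \<in> U" using B(3) g(1) by auto
  qed
  ultimately have triv: "\<rho> (g, 0) = 1\<^sub>m n" if "g \<in> D \<rightarrow>\<^sub>E carrier C" "\<forall>d\<in>F. g d = \<one>\<^bsub>C\<^esub>" for g
    using U(3)[of L "(g, 0)"] that by (auto simp: L_def)
  obtain m where m: "\<And>d. d \<in> F \<Longrightarrow> \<tau> m d \<notin> F" using displace[OF F] by blast
  define f1 where "f1 = (\<lambda>d\<in>D. if d \<in> F then \<one>\<^bsub>C\<^esub> else f d)"
  define f2 where "f2 = (\<lambda>d\<in>D. if d \<in> F then f d else \<one>\<^bsub>C\<^esub>)"
  define g where "g = (\<lambda>d\<in>D. f2 (\<tau> m d))"
  define t where "t = (\<lambda>d\<in>D. \<one>\<^bsub>C\<^esub>, m)"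
  have cl: "f1 \<in> D \<rightarrow>\<^sub>E carrier C" "f2 \<in> D \<rightarrow>\<^sub>E carrier C"
    using f by (auto simp: PiE_iff f1_def f2_def)
  then have gD: "g \<in> D \<rightarrow>\<^sub>E carrier C" using \<tau>_closed by (auto simp: PiE_iff g_def)
  have in_H: "(f1, 0) \<in> carrier ?H" "(f2, 0) \<in> carrier ?H" "(g, 0) \<in> carrier ?H" "t \<in> carrier ?H"
    using cl gD by (auto simp: shift_simps t_def)
  have g1: "\<rho> (g, 0) = \<one>\<^bsub>GL n\<^esub>"
    \<comment> \<open>On \<open>F\<close> the function \<open>g\<close> takes values of
      \<open>f2\<close> at points outside \<open>F\<close>, where \<open>f2\<close> is the
      identity.\<close>
    unfolding GL_simps by (rule triv[OF gD]) (use m F \<tau>_closed in \<open>auto simp: g_def f2_def\<close>)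
  have f1: "\<rho> (f1, 0) = 1\<^sub>m n" by (rule triv[OF cl(1)]) (use F in \<open>auto simp: f1_def\<close>)
  \<comment> \<open>Thus \<open>(g, 0)\<close> is the conjugate of \<open>(f2, 0)\<close> by the
    shift \<open>t\<close>, and triviality of the one image gives triviality of the other.\<close>
  have "t \<otimes>\<^bsub>?H\<^esub> (f2, 0) = (g, 0) \<otimes>\<^bsub>?H\<^esub> t"
    using cl(2) \<tau>_closed \<tau>_zero by (auto simp: shift_simps t_def g_def PiE_iff intro!: restrict_ext)
  then have "\<rho> (t \<otimes>\<^bsub>?H\<^esub> (f2, 0)) = \<rho> ((g, 0) \<otimes>\<^bsub>?H\<^esub> t)" by simp
  then have "\<rho> t \<otimes>\<^bsub>GL n\<^esub> \<rho> (f2, 0) = \<rho> t"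
    using \<rho>.hom_closed[OF in_H(4)]
    by (simp only: \<rho>.hom_mult[OF in_H(4,2)] \<rho>.hom_mult[OF in_H(3,4)] g1 \<rho>.H.l_one)
  then have f2: "\<rho> (f2, 0) = 1\<^sub>m n"
    using \<rho>.H.l_cancel_one[OF \<rho>.hom_closed[OF in_H(4)] \<rho>.hom_closed[OF in_H(2)]]
    by (simp only: GL_simps(3))
  have f_eq: "(f, 0) = (f1, 0) \<otimes>\<^bsub>?H\<^esub> (f2, 0)"
    using f \<tau>_zero by (auto simp: shift_simps f1_def f2_def PiE_iff intro!: extensionalityI[of f D])
  show ?thesis
    unfolding f_eq ordinary_rep_mult[OF rep in_H(1,2)] by (simp add: f1 f2)
qed

lemma carrier_Kor_shift_group: "carrier (Kor shift_group) = (D \<rightarrow>\<^sub>E carrier C) \<times> {0}"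
proof (rule subset_antisym)
  let ?H = shift_group
  interpret H: topological_group ?H by (rule topological_group_shift_group)
  show "(D \<rightarrow>\<^sub>E carrier C) \<times> {0} \<subseteq> carrier (Kor ?H)"
    using ordinary_rep_shift_group_trivial
    by (auto simp: carrier_Kor[OF H.topspace_topol] shift_simps)
  show "carrier (Kor ?H) \<subseteq> (D \<rightarrow>\<^sub>E carrier C) \<times> {0}"
  proof
    fix x assume x: "x \<in> carrier (Kor ?H)"
    have "continuous_map (topol ?H) euclidean ((\<lambda>m. (2::complex) powi m) \<circ> snd)"
      unfolding shift_simps by (rule continuous_map_compose[OF continuous_map_snd]) simp
    then have "(2::complex) powi (snd x) = 1"
      by (intro Kor_character[OF H.topspace_topol _ _ _ x, of "\<lambda>x. 2 powi (snd x)"])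
        (auto simp: shift_simps power_int_add o_def)
    then have "snd x = 0" by (rule two_powi_eq_1)
    then show "x \<in> (D \<rightarrow>\<^sub>E carrier C) \<times> {0}"
      using x topological_group_subset_Kor[OF topological_group_shift_group]
      by (cases x) (auto simp: shift_simps)
  qed
qed

lemma Kor_shift_group: "Kor shift_group \<cong>\<^sub>t P"
proof -
  interpret H: topological_group shift_group by (rule topological_group_shift_group)
  have tsP: "topspace (topol P) = carrier P"
    by (rule topological_groupD(2)[OF topological_group_product[OF C]])
  show ?thesis
  proof (rule topgroup_isoI[of fst _ _ "\<lambda>f. (f, 0)"])
    show "fst \<in> hom (Kor shift_group) P"
      using \<tau>_zero by (auto simp: hom_def carrier_Kor_shift_group shift_simps product_topgroup_simps
          PiE_iff intro!: restrict_ext)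
    show "continuous_map (topol (Kor shift_group)) (topol P) fst"
      by (simp add: shift_simps product_topgroup_simps continuous_map_from_subtopology continuous_map_fst)
    show "continuous_map (topol P) (topol (Kor shift_group)) (\<lambda>f. (f, 0))"
      using tsP by (auto simp: continuous_map_in_subtopology carrier_Kor_shift_group shift_simps
          product_topgroup_simps intro!: continuous_map_pairedI)
  qed (auto simp: carrier_Kor_shift_group product_topgroup_simps C.topspace_topol
      H.topspace_topol shift_simps(1))
qed

lemma power_in_Kor_class_LCG:
  fixes G :: "'u topgroup"
  assumes u: "infinite (UNIV :: 'u set)" and G: "topological_group G" "G \<cong>\<^sub>t P"
  shows "G \<in> Kor_class (LCG :: 'u topgroup set)"
proof (rule Kor_class_LCG_I[OF topological_group_shift_group _ _ G(1)])
  have tP: "topological_group P" by (rule topological_group_product[OF C])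
  show "Kor shift_group \<cong>\<^sub>t G"
    by (rule topgroup_iso_trans[OF Kor_shift_group topgroup_iso_sym[OF G(2,1) tP]])
  have "locally_compact_space (product_topology (\<lambda>_. topol C) D)"
    by (intro compact_imp_locally_compact_space) (auto simp: compact_space_product_topology compact
        Hausdorff_space_product_topology C.Hausdorff_topol)
  then show "locally_compact_space (topol shift_group)"
    by (simp add: shift_simps locally_compact_space_prod_topology locally_compact_space_discrete_topology)
  \<comment> \<open>The size of the power is bounded through \<open>G\<close>, which already lives
    on \<open>'u\<close>.\<close>
  obtain \<phi> where "\<phi> \<in> iso G P" using G(2) by (auto simp: topgroup_iso_def)
  then have "carrier G \<approx> (D \<rightarrow>\<^sub>E carrier C)"
    by (auto simp: iso_def eqpoll_def product_topgroup_simps)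
  then have "(D \<rightarrow>\<^sub>E carrier C) \<lesssim> carrier G"
    by (rule eqpoll_imp_lepoll[OF eqpoll_sym])
  also have "carrier G \<lesssim> (UNIV :: 'u set)" by (rule subset_imp_lepoll) simp
  finally have "(D \<rightarrow>\<^sub>E carrier C) \<lesssim> (UNIV :: 'u set)" .
  then show "carrier shift_group \<lesssim> (UNIV :: 'u set)"
    unfolding shift_simps by (rule times_lepoll_infinite[OF u _ countable_lepoll_infinite[OF u]])
qed (rule topological_group_Kor[OF topological_group_shift_group])

end

text \<open>An infinite set is in bijection with its product with the integers, and translation of
  the integer component gives an action under which every orbit is infinite.\<close>

lemma exists_displacing_action:
  assumes "infinite D"
  obtains \<tau> :: "int \<Rightarrow> 'd \<Rightarrow> 'd" where "\<And>d m. d \<in> D \<Longrightarrow> \<tau> m d \<in> D" "\<And>d. d \<in> D \<Longrightarrow> \<tau> 0 d = d"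
    "\<And>d m k. d \<in> D \<Longrightarrow> \<tau> (m + k) d = \<tau> m (\<tau> k d)"
    "\<And>F. finite F \<Longrightarrow> F \<subseteq> D \<Longrightarrow> \<exists>m. \<forall>d\<in>F. \<tau> m d \<notin> F"
proof -
  have "|D \<times> (UNIV :: int set)| =o |D|"
    using card_of_Times_infinite_simps(1)[OF assms] infinite_iff_card_of_countable[of "UNIV :: int set" D] assms
    by (auto simp: infinite_UNIV_int)
  then obtain b where b: "bij_betw b D (D \<times> (UNIV :: int set))"
    using card_of_ordIso ordIso_symmetric by blast
  define \<tau> where "\<tau> m d = inv_into D b (fst (b d), snd (b d) + m)" for m d
  have bD: "fst (b d) \<in> D" if "d \<in> D" for d
    using bij_betwE[OF b] that by (metis mem_Times_iff)
  have in_img: "(fst (b d), k) \<in> b ` D" if "d \<in> D" for d k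
    using bD[OF that] bij_betw_imp_surj_on[OF b] by simp
  have closed: "\<tau> m d \<in> D" if "d \<in> D" for d m
    unfolding \<tau>_def by (rule inv_into_into[OF in_img[OF that]])
  have b\<tau>: "b (\<tau> m d) = (fst (b d), snd (b d) + m)" if "d \<in> D" for d m
    unfolding \<tau>_def by (rule f_inv_into_f[OF in_img[OF that]])
  have inj: "inj_on b D" using b bij_betw_imp_inj_on by blast
  show thesis
  proof (rule that[of \<tau>])
    show "\<tau> m d \<in> D" if "d \<in> D" for d m by (rule closed[OF that])
    show "\<tau> 0 d = d" if "d \<in> D" for d
      by (rule inj_onD[OF inj]) (use that b\<tau> closed in auto)
    show "\<tau> (m + k) d = \<tau> m (\<tau> k d)" if "d \<in> D" for d m k
      by (rule inj_onD[OF inj]) (use that b\<tau> closed in auto)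
    show "\<exists>m. \<forall>d\<in>F. \<tau> m d \<notin> F" if F: "finite F" "F \<subseteq> D" for F
    proof -
      \<comment> \<open>\<open>S\<close> collects all differences of integer components of points of
        \<open>F\<close>; if a shift by \<open>m\<close> sends a point of \<open>F\<close> into
        \<open>F\<close>, then \<open>m\<close> is such a difference.\<close>
      define S where "S = (\<lambda>(c, d). snd (b c) - snd (b d)) ` (F \<times> F)"
      have "finite S" using F by (simp add: S_def)
      then obtain m where m: "m \<notin> S" using ex_new_if_finite infinite_UNIV_int by blast
      have "\<tau> m d \<notin> F" if d: "d \<in> F" for d
      proof
        assume t: "\<tau> m d \<in> F"
        have "m = snd (b (\<tau> m d)) - snd (b d)" using b\<tau>[of d m] d F by auto
        then have "m \<in> S" using t d by (auto simp: S_def intro!: image_eqI[of _ _ "(\<tau> m d, d)"])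
        then show False using m by blast
      qed
      then show ?thesis by blast
    qed
  qed
qed

theorem mainTheorem13:
  assumes universe: "infinite (UNIV :: 'u set)"
  shows
    "\<comment> \<open>(1)\<close>
     Kor_class (SepLie :: 'u topgroup set) \<union> Kor_class (ConnLCG :: 'u topgroup set)
       \<subseteq> (Kor_class (LCG :: 'u topgroup set) :: 'k topgroup set) \<and>
     (\<forall>G :: 'u topgroup. lie_group G \<and> comm_group G \<and> compactly_generated G
       \<longrightarrow> G \<in> Kor_class (LCG :: 'u topgroup set)) \<and>
     (\<forall>G :: 'u topgroup. topological_group G \<and> compact_space (topol G) \<and> monothetic G
       \<longrightarrow> G \<in> Kor_class (LCG :: 'u topgroup set)) \<and>
     \<comment> \<open>(2)\<close>
     (\<forall>(G :: 'u topgroup) (C :: 'c topgroup) (D :: 'd set).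
       topological_group C \<and> compact_space (topol C) \<and> is_simple C \<and> \<not> comm_group C \<and>
       infinite D \<and> topological_group G \<and> G \<cong>\<^sub>t product_topgroup D (\<lambda>_. C)
       \<longrightarrow> G \<in> Kor_class (LCG :: 'u topgroup set)) \<and>
     \<comment> \<open>(3)\<close>
     (\<forall>G :: 'u topgroup. G \<in> LCG \<and> is_simple G \<and> \<not> discrete_topgroup G \<and>
       totally_disconnected_space (topol G)
       \<longrightarrow> G \<in> Kor_class (LCG :: 'u topgroup set)) \<and>
     \<comment> \<open>(4)\<close>
     (\<forall>G :: 'u topgroup. topological_group G \<and> is_simple G \<and> discrete_topgroup G \<and>
       (UNIV :: nat set set) \<prec> carrier G
       \<longrightarrow> G \<in> Kor_class (LCG :: 'u topgroup set)) \<and>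
     \<comment> \<open>(5)\<close>
     (\<forall>G :: 'u topgroup. topological_group G \<and> is_simple G \<and> discrete_topgroup G \<and>
       (\<exists>E. subgroup E G \<and> infinite E \<and> elementary_abelian (G\<lparr>carrier := E\<rparr>))
       \<longrightarrow> G \<in> Kor_class (LCG :: 'u topgroup set)) \<and>
     \<comment> \<open>closure under finite, but not under arbitrary, cartesian products\<close>
     (\<forall>(I :: 'i set) (G :: 'i \<Rightarrow> 'k topgroup).
       finite I \<and> (\<forall>i\<in>I. G i \<in> Kor_class (LCG :: 'u topgroup set))
       \<longrightarrow> product_topgroup I G \<in> Kor_class (LCG :: 'u topgroup set)) \<and>
     \<not> (\<forall>(I :: nat set) (G :: nat \<Rightarrow> real topgroup).
       (\<forall>i\<in>I. G i \<in> Kor_class (LCG :: 'u topgroup set))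
       \<longrightarrow> product_topgroup I G \<in> Kor_class (LCG :: 'u topgroup set))"
proof (intro conjI allI impI)
  show "Kor_class (SepLie :: 'u topgroup set) \<union> Kor_class (ConnLCG :: 'u topgroup set)
      \<subseteq> (Kor_class (LCG :: 'u topgroup set) :: 'k topgroup set)"
    using lie_group_locally_compact by (fastforce simp: Kor_class_def SepLie_def ConnLCG_def LCG_def)
next
  fix G :: "'u topgroup"
  assume "lie_group G \<and> comm_group G \<and> compactly_generated G"
  then show "G \<in> Kor_class (LCG :: 'u topgroup set)"
    using abelian_in_Kor_class_LCG[OF universe _ _ _ _ topgroup_iso_refl] lie_group_locally_compact
    by blast
next
  fix G :: "'u topgroup"
  assume G: "topological_group G \<and> compact_space (topol G) \<and> monothetic G"
  then have "locally_compact_space (topol G)"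
    by (simp add: compact_imp_locally_compact_space)
  with G show "G \<in> Kor_class (LCG :: 'u topgroup set)"
    using abelian_in_Kor_class_LCG[OF universe _ _ _ _ topgroup_iso_refl] monothetic_imp_comm_group
    by blast
next
  fix G :: "'u topgroup" and C :: "'c topgroup" and D :: "'d set"
  assume *: "topological_group C \<and> compact_space (topol C) \<and> is_simple C \<and> \<not> comm_group C \<and>
    infinite D \<and> topological_group G \<and> G \<cong>\<^sub>t product_topgroup D (\<lambda>_. C)"
  then obtain \<tau> :: "int \<Rightarrow> 'd \<Rightarrow> 'd" where "\<And>d m. d \<in> D \<Longrightarrow> \<tau> m d \<in> D" "\<And>d. d \<in> D \<Longrightarrow> \<tau> 0 d = d"
    "\<And>d m k. d \<in> D \<Longrightarrow> \<tau> (m + k) d = \<tau> m (\<tau> k d)"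
    "\<And>F. finite F \<Longrightarrow> F \<subseteq> D \<Longrightarrow> \<exists>m. \<forall>d\<in>F. \<tau> m d \<notin> F"
    using exists_displacing_action[of D] by blast
  with * interpret shifted_power D C \<tau> by (intro shifted_power.intro) blast+
  show "G \<in> Kor_class (LCG :: 'u topgroup set)"
    using power_in_Kor_class_LCG[OF universe] * by blast
next
  fix G :: "'u topgroup"
  assume "G \<in> LCG \<and> is_simple G \<and> \<not> discrete_topgroup G \<and> totally_disconnected_space (topol G)"
  then show "G \<in> Kor_class (LCG :: 'u topgroup set)"
    using simple_totally_disconnected_in_Kor_class_LCG by blast
next
  fix G :: "'u topgroup"
  assume "topological_group G \<and> is_simple G \<and> discrete_topgroup G \<and>
    (UNIV :: nat set set) \<prec> carrier G"
  then show "G \<in> Kor_class (LCG :: 'u topgroup set)"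
    using large_simple_in_Kor_class_LCG by blast
next
  fix G :: "'u topgroup"
  assume "topological_group G \<and> is_simple G \<and> discrete_topgroup G \<and>
    (\<exists>E. subgroup E G \<and> infinite E \<and> elementary_abelian (G\<lparr>carrier := E\<rparr>))"
  then show "G \<in> Kor_class (LCG :: 'u topgroup set)"
    using noninjective_reps_in_Kor_class_LCG infinite_elementary_abelian_noninjective by blast
next
  fix I :: "'i set" and G :: "'i \<Rightarrow> 'k topgroup"
  assume "finite I \<and> (\<forall>i\<in>I. G i \<in> Kor_class (LCG :: 'u topgroup set))"
  then show "product_topgroup I G \<in> Kor_class (LCG :: 'u topgroup set)"
    using finite_product_in_Kor_class_LCG[OF universe] by blast
next
  show "\<not> (\<forall>(I :: nat set) (G :: nat \<Rightarrow> real topgroup).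
       (\<forall>i\<in>I. G i \<in> Kor_class (LCG :: 'u topgroup set))
       \<longrightarrow> product_topgroup I G \<in> Kor_class (LCG :: 'u topgroup set))"
  proof
    assume "\<forall>(I :: nat set) (G :: nat \<Rightarrow> real topgroup).
       (\<forall>i\<in>I. G i \<in> Kor_class (LCG :: 'u topgroup set))
       \<longrightarrow> product_topgroup I G \<in> Kor_class (LCG :: 'u topgroup set)"
    from this[rule_format, of UNIV "\<lambda>_. discrete_int"] show False
      using discrete_int_in_Kor_class_LCG[OF universe] infinite_product_not_in_Kor_class_LCG by blast
  qed
qed

end
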